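(* Let $w=w(x_1,\dots,x_r)$ be an outer commutator word, let $\mathcal W$ be the variety defined by $w$, and let $\mathcal V$ be the variety of groups defined by the single commutator word $[w,x_{r+1},x_{r+2}]=[[w(x_1,\dots,x_r),x_{r+1}],x_{r+2}]$. Let $G$ be a finite group with a VP cover $1\to L\to G^*\to G\to 1$ (with respect to $\mathcal V$), where $L$ is regarded as a subgroup of $G^*$. Let $H$ be a subgroup of index $n$ in $G$, and let $B$ be a subgroup of $G^*$ containing $L$ with $H\cong B/L$. Then $[W(B),\mathcal V\tilde{B_0}(G)^n]$ is isomorphic to a subgroup of $\mathcal V\tilde{B_0}(H)$, where $\mathcal V\tilde{B_0}(G)$ is identified with $L$ via $L\cong\mathcal V\tilde{B_0}(G)$; that is, $[W(B),L^n]$, with $L^n=\{x^n : x\in L\}$, is isomorphic to a subgroup of $\mathcal V\tilde{B_0}(H)$.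
   Context: Commutators: $[x,y]=x^{-1}y^{-1}xy$, $[x_1,\dots,x_n]=[[x_1,\dots,x_{n-1}],x_n]$, and for subgroups $M,N$, $[M,N]$ is the subgroup generated by all $[m,n]$, $m\in M,n\in N$. Outer commutator words are defined inductively: a variable $x_i$ is an outer commutator word of weight one; if $u(x_1,\dots,x_s)$ and $v(x_{s+1},\dots,x_{s+t})$ are outer commutator words of weights $s,t$ in disjoint variables, then $[u(x_1,\dots,x_s),v(x_{s+1},\dots,x_{s+t})]$ is an outer commutator word of weight $s+t$. For a variety $\mathcal V$ defined by a set $V$ of outer commutator words and a group $E$: $T(E)=\{v(e_1,\dots,e_s) : v\in V,\ e_i\in E\}$; the verbal subgroup $V(E)$ is the subgroup generated by $T(E)$; the marginal subgroup $V^*(E)$ is the set of $a\in E$ such that $v(e_1,\dots,e_ia,\dots,e_s)=v(e_1,\dots,e_s)$ for all $v\in V$, all $e_1,\dots,e_s\in E$ and all $i$. $W(E)$ denotes the verbal subgroup of $E$ for the word $w$. If $E\cong F/R$ is a free presentation, the $\tilde{B_0}$-invariant is $\mathcal V\tilde{B_0}(E)=\dfrac{R\cap V(F)}{\langle T(F)\cap R\rangle}$; it is abelian and independent, up to isomorphism, of the free presentation. An extension $1\to N\xrightarrow{\chi}E\to Q\to 1$ is marginal if $\chi(N)\subseteq V^*(E)$; a marginal extension is a VP extension if and only if $\chi(N)\cap T(E)=1$. A marginal VP extension is $\mathcal V$-stem if $\chi(N)\subseteq V(E)$. A VP cover of $Q$ is a $\mathcal V$-stem marginal VP extension $1\to N\xrightarrow{\chi}E\to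 Q\to 1$ with $N\cong\mathcal V\tilde{B_0}(Q)$. Thus for the VP cover in the claim, $L\le V^*(G^* )\cap V(G^* )$, $L\cap T(G^* )=1$ and $L\cong\mathcal V\tilde{B_0}(G)$. *)

theory Defs
  imports "HOL-Algebra.Generated_Groups"
begin

datatype comm_word = Var nat | Comm comm_word comm_word

primrec word_vars :: "comm_word \<Rightarrow> nat set" where
  "word_vars (Var i) = {i}"
| "word_vars (Comm u v) = word_vars u \<union> word_vars v"

inductive outer_commutator_word :: "comm_word \<Rightarrow> bool" where
  "outer_commutator_word (Var i)"
| "outer_commutator_word u \<Longrightarrow> outer_commutator_word v \<Longrightarrow> word_vars u \<inter> word_vars v = {}
    \<Longrightarrow> outer_commutator_word (Comm u v)"

text \<open>The convention is $[x,y] = x^{-1}y^{-1}xy$; the library's derived subgroup is built from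
  $xyx^{-1}y^{-1}$.\<close>

definition commutator :: "('a, 'm) monoid_scheme \<Rightarrow> 'a \<Rightarrow> 'a \<Rightarrow> 'a" where
  "commutator G x y = inv\<^bsub>G\<^esub> x \<otimes>\<^bsub>G\<^esub> inv\<^bsub>G\<^esub> y \<otimes>\<^bsub>G\<^esub> x \<otimes>\<^bsub>G\<^esub> y"

definition commutator_subgroup :: "('a, 'm) monoid_scheme \<Rightarrow> 'a set \<Rightarrow> 'a set \<Rightarrow> 'a set" where
  "commutator_subgroup G M N = generate G {commutator G m k | m k. m \<in> M \<and> k \<in> N}"

text \<open>An assignment \<open>e\<close> gives a value to every variable; only its values on the variables of the
  word matter.\<close>

primrec word_eval :: "('a, 'm) monoid_scheme \<Rightarrow> (nat \<Rightarrow> 'a) \<Rightarrow> comm_word \<Rightarrow> 'a" where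
  "word_eval G e (Var i) = e i"
| "word_eval G e (Comm u v) = commutator G (word_eval G e u) (word_eval G e v)"

text \<open>A variety is represented by its set \<open>V\<close> of defining words. The next three definitions are
  $T(G)$, $V(G)$ and $V^*(G)$.\<close>

definition word_values :: "comm_word set \<Rightarrow> ('a, 'm) monoid_scheme \<Rightarrow> 'a set" where
  "word_values V G = {word_eval G e v | e v. v \<in> V \<and> (\<forall>i. e i \<in> carrier G)}"

definition verbal_subgroup :: "comm_word set \<Rightarrow> ('a, 'm) monoid_scheme \<Rightarrow> 'a set" where
  "verbal_subgroup V G = generate G (word_values V G)"

definition marginal_subgroup :: "comm_word set \<Rightarrow> ('a, 'm) monoid_scheme \<Rightarrow> 'a set" where
  "marginal_subgroup V G = {a \<in> carrier G.
     \<forall>v \<in> V. \<forall>e. (\<forall>i. e i \<in> carrier G) \<longrightarrow>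
       (\<forall>i \<in> word_vars v. word_eval G (e(i := e i \<otimes>\<^bsub>G\<^esub> a)) v = word_eval G e v)}"

text \<open>The letter \<open>(x, True)\<close> stands for $x$ and \<open>(x, False)\<close> for $x^{-1}$. A group is free on \<open>X\<close> if
  \<open>X\<close> generates it and no nonempty reduced word in \<open>X\<close> and its inverses is trivial.\<close>

definition signed_prod :: "('a, 'm) monoid_scheme \<Rightarrow> ('a \<times> bool) list \<Rightarrow> 'a" where
  "signed_prod G ws = foldr (\<lambda>(x, b) y. (if b then x else inv\<^bsub>G\<^esub> x) \<otimes>\<^bsub>G\<^esub> y) ws \<one>\<^bsub>G\<^esub>"

definition reduced_word :: "('a \<times> bool) list \<Rightarrow> bool" where
  "reduced_word ws = successively (\<lambda>(x, b) (y, c). x = y \<longrightarrow> b = c) ws"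

definition free_on :: "('a, 'm) monoid_scheme \<Rightarrow> 'a set \<Rightarrow> bool" where
  "free_on F X \<longleftrightarrow> group F \<and> X \<subseteq> carrier F \<and> generate F X = carrier F \<and>
     (\<forall>ws. ws \<noteq> [] \<and> fst ` set ws \<subseteq> X \<and> reduced_word ws \<longrightarrow> signed_prod F ws \<noteq> \<one>\<^bsub>F\<^esub>)"

definition free_presentation ::
    "('f, 'm) monoid_scheme \<Rightarrow> 'f set \<Rightarrow> ('q, 'n) monoid_scheme \<Rightarrow> bool" where
  "free_presentation F R Q \<longleftrightarrow> (\<exists>X. free_on F X) \<and> R \<lhd> F \<and> (F Mod R) \<cong> Q"

text \<open>The $\tilde{B_0}$-invariant of $F/R$, computed from this presentation. Up to isomorphism it does
  not depend on the presentation; since a definition cannot quantify over the type of \<open>F\<close>, the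
  presentation is kept as a parameter.\<close>

definition B0_invariant ::
    "comm_word set \<Rightarrow> ('f, 'm) monoid_scheme \<Rightarrow> 'f set \<Rightarrow> 'f set monoid" where
  "B0_invariant V F R =
     F\<lparr>carrier := R \<inter> verbal_subgroup V F\<rparr> Mod generate F (word_values V F \<inter> R)"

definition group_extension ::
    "('n, 'k) monoid_scheme \<Rightarrow> ('n \<Rightarrow> 'e) \<Rightarrow> ('e, 'l) monoid_scheme \<Rightarrow> ('e \<Rightarrow> 'q) \<Rightarrow>
     ('q, 'm) monoid_scheme \<Rightarrow> bool" where
  "group_extension N \<chi> E \<sigma> Q \<longleftrightarrow> group N \<and> group E \<and> group Q \<and>
     \<chi> \<in> hom N E \<and> inj_on \<chi> (carrier N) \<and>
     \<sigma> \<in> hom E Q \<and> \<sigma> ` carrier E = carrier Q \<and> kernel E Q \<sigma> = \<chi> ` carrier N"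

definition marginal_extension ::
    "comm_word set \<Rightarrow> ('n, 'k) monoid_scheme \<Rightarrow> ('n \<Rightarrow> 'e) \<Rightarrow> ('e, 'l) monoid_scheme \<Rightarrow>
     ('e \<Rightarrow> 'q) \<Rightarrow> ('q, 'm) monoid_scheme \<Rightarrow> bool" where
  "marginal_extension V N \<chi> E \<sigma> Q \<longleftrightarrow>
     group_extension N \<chi> E \<sigma> Q \<and> \<chi> ` carrier N \<subseteq> marginal_subgroup V E"

definition marginal_VP_extension ::
    "comm_word set \<Rightarrow> ('n, 'k) monoid_scheme \<Rightarrow> ('n \<Rightarrow> 'e) \<Rightarrow> ('e, 'l) monoid_scheme \<Rightarrow>
     ('e \<Rightarrow> 'q) \<Rightarrow> ('q, 'm) monoid_scheme \<Rightarrow> bool" where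
  "marginal_VP_extension V N \<chi> E \<sigma> Q \<longleftrightarrow>
     marginal_extension V N \<chi> E \<sigma> Q \<and> \<chi> ` carrier N \<inter> word_values V E = {\<one>\<^bsub>E\<^esub>}"

definition stem_VP_extension ::
    "comm_word set \<Rightarrow> ('n, 'k) monoid_scheme \<Rightarrow> ('n \<Rightarrow> 'e) \<Rightarrow> ('e, 'l) monoid_scheme \<Rightarrow>
     ('e \<Rightarrow> 'q) \<Rightarrow> ('q, 'm) monoid_scheme \<Rightarrow> bool" where
  "stem_VP_extension V N \<chi> E \<sigma> Q \<longleftrightarrow>
     marginal_VP_extension V N \<chi> E \<sigma> Q \<and> \<chi> ` carrier N \<subseteq> verbal_subgroup V E"

text \<open>\<open>F\<close>, \<open>R\<close> is the free presentation of \<open>Q\<close> used to compute the invariant.\<close>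

definition VP_cover ::
    "comm_word set \<Rightarrow> ('f, 'j) monoid_scheme \<Rightarrow> 'f set \<Rightarrow> ('n, 'k) monoid_scheme \<Rightarrow> ('n \<Rightarrow> 'e) \<Rightarrow>
     ('e, 'l) monoid_scheme \<Rightarrow> ('e \<Rightarrow> 'q) \<Rightarrow> ('q, 'm) monoid_scheme \<Rightarrow> bool" where
  "VP_cover V F R N \<chi> E \<sigma> Q \<longleftrightarrow>
     stem_VP_extension V N \<chi> E \<sigma> Q \<and> free_presentation F R Q \<and> N \<cong> B0_invariant V F R"

end

(* Write E for the cover of G. The subgroup L of E is abelian, normal, and meets the values of v =
   [w, x, y] trivially, so every [w, l] is central and L centralizes [W(E), E]. Hence conjugating l
   does not change its action on W(E), and the transfer into B, taken modulo the elements of B that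
   centralize W(B) modulo V(B), sends l to the class of l^n. It kills commutators and l lies in
   V(E), so [W(B), l^n] lies in V(B).

   Lifting a free presentation F/R of H to B maps R \<inter> V(F) onto L \<inter> V(B) and induces a
   homomorphism from the invariant of H, which therefore has [W(B), L^n] as a section. For an outer
   commutator word and R of finite index, a transfer argument by induction on the word shows that
   V(F) has finite exponent modulo its trivial values; so the invariant of H is abelian and torsion,
   L is finite, and a finite section of an abelian torsion group embeds into it. *)

theory Submission
  imports Defs "HOL-Algebra.Multiplicative_Group" "HOL-Computational_Algebra.Primes"
begin

section \<open>Transfer and power maps\<close>

text \<open>The kernel L need not be central in the cover, so the transfer of l is a product of
  conjugates that can differ. Modulo the derived subgroup of B they need not agree, as the
  conjugating elements range over the whole cover; modulo the elements acting trivially on W(B)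
  modulo V(B) they do, and that quotient is still abelian. The isomorphism of H with B/L is
  abstract: B need not be the preimage of H, so its index is found by counting.

  The free group may have infinite rank, so nothing on its side is visibly finitely generated. A
  bounded exponent can be proved by induction on the word without generators, and it is enough: an
  infinite quotient of an abelian torsion group need not embed (a Pruefer group is a quotient of a
  direct sum of cyclic groups), but a finite one comes from a finite subgroup. Finiteness is
  obtained on the side of the cover, where v has only finitely many values.

  One congruence serves everywhere: changing the arguments of an outer commutator word within cosets
  of a normal subgroup R changes its value only by elements generated by the values in R.\<close>

lemma (in group) transfer:
  assumes H: "subgroup H G" and fin: "finite (rcosets H)"
    and A: "comm_group A" and phi: "\<phi> \<in> hom (G\<lparr>carrier := H\<rparr>) A"
  obtains \<tau> where "\<tau> \<in> hom G A"
    and "\<And>h. h \<in> carrier G \<Longrightarrow> (\<And>x. x \<in> carrier G \<Longrightarrow> x \<otimes> h \<otimes> inv x \<in> H) \<Longrightarrow>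
       (\<And>x. x \<in> carrier G \<Longrightarrow> \<phi> (x \<otimes> h \<otimes> inv x) = \<phi> h) \<Longrightarrow> \<tau> h = \<phi> h [^]\<^bsub>A\<^esub> card (rcosets H)"
proof -
  interpret A: comm_group A by (rule A)
  have phim: "\<phi> (x \<otimes> y) = \<phi> x \<otimes>\<^bsub>A\<^esub> \<phi> y" if "x \<in> H" "y \<in> H" for x y
    using phi that by (auto simp: hom_def)
  have phic: "\<phi> x \<in> carrier A" if "x \<in> H" for x
    using phi that by (auto simp: hom_def)
  define \<rho> where "\<rho> C = (SOME x. x \<in> carrier G \<and> C = H #> x)" for C
  have rho: "\<rho> C \<in> carrier G \<and> C = H #> \<rho> C" if "C \<in> rcosets H" for C
    unfolding \<rho>_def by (rule someI_ex) (use that in \<open>auto simp: RCOSETS_def\<close>)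
  have act: "C #> g \<in> rcosets H" if "C \<in> rcosets H" "g \<in> carrier G" for C g
    using that rho[OF that(1)] by (metis coset_mult_assoc m_closed rcosetsI H subgroup.subset)
  \<comment> \<open>\<open>d C g\<close> is the element of H by which g misses the chosen
    representative of the next coset. It satisfies a cocycle identity, which makes the product over
    all cosets multiplicative in an abelian target.\<close>
  define d where "d C g = \<rho> C \<otimes> g \<otimes> inv (\<rho> (C #> g))" for C g
  have dH: "d C g \<in> H" if C: "C \<in> rcosets H" and g: "g \<in> carrier G" for C g
  proof -
    have "H #> (\<rho> C \<otimes> g) = H #> \<rho> (C #> g)"
      using rho[OF C] rho[OF act[OF C g]] g H by (metis coset_mult_assoc subgroup.subset)
    then have "\<rho> C \<otimes> g \<in> H #> \<rho> (C #> g)"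
      using rho[OF C] g H by (metis m_closed rcos_self)
    then show ?thesis
      unfolding d_def using H rho[OF C] rho[OF act[OF C g]] g
      by (metis is_group m_closed subgroup.rcos_module_imp)
  qed
  have dm: "d C (g \<otimes> h) = d C g \<otimes> d (C #> g) h"
    if C: "C \<in> rcosets H" and g: "g \<in> carrier G" and h: "h \<in> carrier G" for C g h
  proof -
    have e: "C #> g #> h = C #> (g \<otimes> h)"
      using C g h H by (simp add: coset_mult_assoc subgroup.rcosets_carrier[OF H is_group])
    have c: "\<rho> C \<in> carrier G" "\<rho> (C #> g) \<in> carrier G" "\<rho> (C #> (g \<otimes> h)) \<in> carrier G"
      using rho act C g h by auto
    then show ?thesis
      using g h by (simp add: d_def e m_assoc inv_solve_left)
  qed
  define \<tau> where "\<tau> g = finprod A (\<lambda>C. \<phi> (d C g)) (rcosets H)" for g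
  have "\<tau> \<in> hom G A"
  proof (rule homI)
    show "\<tau> g \<in> carrier A" if "g \<in> carrier G" for g
      unfolding \<tau>_def using that by (auto intro!: A.finprod_closed phic dH)
  next
    fix g h assume g: "g \<in> carrier G" and h: "h \<in> carrier G"
    \<comment> \<open>Right multiplication by g permutes the cosets, so the product over shifted
      cosets can be reindexed; finiteness turns injectivity into surjectivity.\<close>
    have inj: "inj_on (\<lambda>C. C #> g) (rcosets H)"
    proof (rule inj_onI)
      fix C D assume "C \<in> rcosets H" "D \<in> rcosets H" "C #> g = D #> g"
      then show "C = D"
        using g by (metis H coset_mult_inv1 coset_mult_inv2 coset_mult_assoc coset_mult_one inv_closed is_group r_inv subgroup.rcosets_carrier)
    qed
    have im: "(\<lambda>C. C #> g) ` (rcosets H) = rcosets H"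
      by (rule endo_inj_surj[OF fin _ inj]) (use act g in auto)
    have "\<tau> (g \<otimes> h) = finprod A (\<lambda>C. \<phi> (d C g) \<otimes>\<^bsub>A\<^esub> \<phi> (d (C #> g) h)) (rcosets H)"
      unfolding \<tau>_def by (rule A.finprod_cong') (use dm dH phim phic act g h in auto)
    also have "\<dots> = \<tau> g \<otimes>\<^bsub>A\<^esub> finprod A (\<lambda>C. \<phi> (d (C #> g) h)) (rcosets H)"
      unfolding \<tau>_def by (rule A.finprod_multf) (use dH phic act g h in auto)
    also have "finprod A (\<lambda>C. \<phi> (d (C #> g) h)) (rcosets H) = \<tau> h"
    proof -
      have "finprod A (\<lambda>C. \<phi> (d C h)) ((\<lambda>C. C #> g) ` (rcosets H))
          = finprod A (\<lambda>C. \<phi> (d (C #> g) h)) (rcosets H)"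
        by (rule A.finprod_reindex) (use dH phic act g h inj in auto)
      then show ?thesis by (simp add: im \<tau>_def)
    qed
    finally show "\<tau> (g \<otimes> h) = \<tau> g \<otimes>\<^bsub>A\<^esub> \<tau> h" .
  qed
  moreover have "\<tau> h = \<phi> h [^]\<^bsub>A\<^esub> card (rcosets H)"
    if h: "h \<in> carrier G" and hH: "\<And>x. x \<in> carrier G \<Longrightarrow> x \<otimes> h \<otimes> inv x \<in> H"
      and eq: "\<And>x. x \<in> carrier G \<Longrightarrow> \<phi> (x \<otimes> h \<otimes> inv x) = \<phi> h" for h
  proof -
    \<comment> \<open>If all conjugates of h lie in H, then h fixes every coset, and each factor of
      the transfer is a conjugate of h.\<close>
    have d: "d C h = \<rho> C \<otimes> h \<otimes> inv (\<rho> C)" if C: "C \<in> rcosets H" for C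
    proof -
      have r: "\<rho> C \<in> carrier G" "C = H #> \<rho> C" using rho[OF C] by auto
      have "C #> h = H #> (\<rho> C \<otimes> h)"
        using r h H by (metis coset_mult_assoc subgroup.subset)
      also have "\<dots> = H #> (\<rho> C \<otimes> h \<otimes> inv (\<rho> C)) #> \<rho> C"
        using r h H by (simp add: coset_mult_assoc subgroup.subset m_assoc)
      also have "\<dots> = C"
        using hH[OF r(1)] r H coset_join2 h by (metis inv_closed m_closed)
      finally show ?thesis by (simp add: d_def)
    qed
    have "h \<in> H" using hH[of \<one>] h by simp
    then have "\<phi> h \<in> carrier A" by (rule phic)
    moreover have "\<tau> h = finprod A (\<lambda>C. \<phi> h) (rcosets H)"
      unfolding \<tau>_def by (rule A.finprod_cong') (use d eq rho calculation in auto)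
    ultimately show ?thesis by (simp add: A.finprod_const)
  qed
  ultimately show thesis using that by blast
qed

lemma (in group) power_in_normal_of_finite_index:
  assumes N: "N \<lhd> G" and fin: "finite (rcosets N)" and x: "x \<in> carrier G"
  shows "x [^] card (rcosets N) \<in> N"
proof -
  interpret N: normal N G by (rule N)
  interpret Q: group "G Mod N" by (rule N.factorgroup_is_group)
  have "(N #> x) [^]\<^bsub>G Mod N\<^esub> order (G Mod N) = \<one>\<^bsub>G Mod N\<^esub>"
    by (rule Q.pow_order_eq_1) (use x in \<open>auto simp: carrier_FactGroup\<close>)
  then have "N #> (x [^] card (rcosets N)) = N"
    using N.FactGroup_pow[OF x] by (simp add: order_def FactGroup_def)
  then show ?thesis
    using x by (metis N.subgroup_axioms coset_join1 nat_pow_closed N.subset)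
qed

text \<open>The exponent comes from composing the transfer into the centre with the \<open>d\<close>-th power map.\<close>

lemma (in group) central_power_hom:
  assumes Z: "subgroup Z G" and fin: "finite (rcosets Z)"
    and central: "\<And>z x. z \<in> Z \<Longrightarrow> x \<in> carrier G \<Longrightarrow> z \<otimes> x = x \<otimes> z"
  obtains m :: nat where "m > 0" "(\<lambda>x. x [^] m) \<in> hom G (G\<lparr>carrier := Z\<rparr>)"
proof -
  interpret Z: subgroup Z G by (rule Z)
  let ?Z = "G\<lparr>carrier := Z\<rparr>"
  let ?d = "card (rcosets Z)"
  have conj: "x \<otimes> z \<otimes> inv x = z" if "z \<in> Z" "x \<in> carrier G" for z x
    using central[OF that] that by (metis Z.mem_carrier m_assoc r_inv r_one inv_closed)
  have N: "Z \<lhd> G"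
    unfolding normal_inv_iff using Z conj by auto
  have cg: "comm_group ?Z"
    by (rule group.group_comm_groupI[OF subgroup.subgroup_is_group[OF Z is_group]])
       (use central Z.mem_carrier in auto)
  interpret C: comm_group ?Z by (rule cg)
  have "(\<lambda>x. x) \<in> hom ?Z ?Z" by (simp add: hom_def)
  from transfer[OF Z fin cg this] obtain \<tau> where tau: "\<tau> \<in> hom G ?Z"
    and tauz: "\<And>z. z \<in> Z \<Longrightarrow> \<tau> z = z [^]\<^bsub>?Z\<^esub> ?d"
    using conj Z.mem_carrier by (metis (no_types, lifting))
  interpret T: group_hom G ?Z \<tau>
    using tau by (simp add: group_hom_def group_hom_axioms_def is_group C.is_group)
  \<comment> \<open>The d-th power of x already lies in Z, where \<open>\<tau>\<close> is the d-th
    power map. Evaluating \<open>\<tau>\<close> there in two ways gives the identity.\<close>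
  have eq: "x [^] (?d * ?d) = \<tau> x [^]\<^bsub>?Z\<^esub> ?d" if x: "x \<in> carrier G" for x
  proof -
    have "\<tau> (x [^] ?d) = x [^] (?d * ?d)"
      using tauz[OF power_in_normal_of_finite_index[OF N fin x]] x
      by (simp add: nat_pow_pow flip: nat_pow_consistent)
    then show ?thesis using T.hom_nat_pow[OF x] by simp
  qed
  have hom: "(\<lambda>x. \<tau> x [^]\<^bsub>?Z\<^esub> ?d) \<in> hom G ?Z"
  proof (rule homI)
    fix x y assume xy: "x \<in> carrier G" "y \<in> carrier G"
    then show "\<tau> (x \<otimes> y) [^]\<^bsub>?Z\<^esub> ?d = \<tau> x [^]\<^bsub>?Z\<^esub> ?d \<otimes>\<^bsub>?Z\<^esub> \<tau> y [^]\<^bsub>?Z\<^esub> ?d"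
      by (metis C.nat_pow_distrib T.hom_closed T.hom_mult)
  qed (use C.nat_pow_closed T.hom_closed in blast)
  have "(\<lambda>x. x [^] (?d * ?d)) \<in> hom G ?Z"
  proof (rule homI)
    fix x y assume "x \<in> carrier G" "y \<in> carrier G"
    then show "(x \<otimes> y) [^] (?d * ?d) = x [^] (?d * ?d) \<otimes>\<^bsub>?Z\<^esub> y [^] (?d * ?d)"
      using hom_mult[OF hom] eq by simp
  qed (use eq hom_in_carrier[OF hom] in simp)
  moreover have "?d * ?d > 0"
    using fin Z.subgroup_in_rcosets[OF is_group] by (auto simp: card_gt_0_iff)
  ultimately show thesis using that by blast
qed

lemma (in group) subgroup_nat_pow_closed:
  fixes k :: nat
  shows "subgroup H G \<Longrightarrow> x \<in> H \<Longrightarrow> x [^] k \<in> H"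
  using subgroup_int_pow_closed[of H x "int k"] by (simp add: int_pow_int)

section \<open>Values of outer commutator words\<close>

lemma (in group) commutator_closed [simp, intro]:
  "x \<in> carrier G \<Longrightarrow> y \<in> carrier G \<Longrightarrow> commutator G x y \<in> carrier G"
  by (simp add: commutator_def)

lemma (in group) word_eval_closed [intro]:
  "(\<And>i. e i \<in> carrier G) \<Longrightarrow> word_eval G e v \<in> carrier G"
  by (induction v) auto

lemma (in group_hom) hom_commutator:
  "x \<in> carrier G \<Longrightarrow> y \<in> carrier G \<Longrightarrow> h (commutator G x y) = commutator H (h x) (h y)"
  by (simp add: commutator_def)

lemma (in group_hom) hom_word_eval:
  "(\<And>i. e i \<in> carrier G) \<Longrightarrow> h (word_eval G e v) = word_eval H (\<lambda>i. h (e i)) v"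
  by (induction v) (simp_all add: hom_commutator G.word_eval_closed)

lemma word_eval_cong:
  "(\<And>i. i \<in> word_vars v \<Longrightarrow> e i = e' i) \<Longrightarrow> word_eval G e v = word_eval G e' v"
  by (induction v) auto

lemma (in group) word_eval_subgroup:
  assumes "subgroup B G" "\<And>i. e i \<in> B"
  shows "word_eval (G\<lparr>carrier := B\<rparr>) e v = word_eval G e v"
proof -
  interpret S: group "G\<lparr>carrier := B\<rparr>" by (rule subgroup.subgroup_is_group[OF assms(1) is_group])
  have mem: "word_eval (G\<lparr>carrier := B\<rparr>) e v \<in> B" for v
    using S.word_eval_closed[of e v] assms(2) by simp
  show ?thesis
  proof (induction v)
    case (Comm u v)
    have "word_eval G e u \<in> B" "word_eval G e v \<in> B"
      using Comm.IH mem by metis+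
    then show ?case
      using Comm.IH by (simp add: commutator_def m_inv_consistent[OF assms(1)])
  qed simp
qed

lemma word_values_single: "word_values {v} G = {word_eval G e v | e. \<forall>i. e i \<in> carrier G}"
  by (auto simp: word_values_def)

lemma word_values_Var: "word_values {Var i} G = carrier G"
  by (auto simp: word_values_single intro!: exI[of _ "\<lambda>_. _"])

lemma (in group) word_values_carrier: "word_values {v} G \<subseteq> carrier G"
  by (auto simp: word_values_single)

text \<open>Disjoint variables allow an assignment for u and one for v to be glued together, so the
  two entries of the commutator vary independently.\<close>

lemma (in group) word_values_comm:
  assumes "word_vars u \<inter> word_vars v = {}"
  shows "word_values {Comm u v} G
       = {commutator G a b | a b. a \<in> word_values {u} G \<and> b \<in> word_values {v} G}"
proof
  show "word_values {Comm u v} G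
       \<subseteq> {commutator G a b | a b. a \<in> word_values {u} G \<and> b \<in> word_values {v} G}"
    by (fastforce simp: word_values_single)
next
  have "commutator G (word_eval G e u) (word_eval G f v) \<in> word_values {Comm u v} G"
    if e: "\<forall>i. e i \<in> carrier G" and f: "\<forall>i. f i \<in> carrier G" for e f
  proof -
    define g where "g i = (if i \<in> word_vars u then e i else f i)" for i
    have "word_eval G g u = word_eval G e u" "word_eval G g v = word_eval G f v"
      using assms by (auto intro!: word_eval_cong simp: g_def)
    then have "commutator G (word_eval G e u) (word_eval G f v) = word_eval G g (Comm u v)"
      by simp
    moreover have "\<forall>i. g i \<in> carrier G" using e f by (simp add: g_def)
    ultimately show ?thesis unfolding word_values_single by blast
  qed
  then show "{commutator G a b | a b. a \<in> word_values {u} G \<and> b \<in> word_values {v} G}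
       \<subseteq> word_values {Comm u v} G"
    by (auto simp: word_values_single[of u] word_values_single[of v])
qed

section \<open>Commutators modulo a normal subgroup\<close>

lemma (in normal) mem_iff_coset:
  assumes x: "x \<in> carrier G"
  shows "x \<in> H \<longleftrightarrow> H #> x = H"
proof
  show "H #> x = H" if "x \<in> H" by (rule coset_join2[OF x subgroup_axioms that])
  show "x \<in> H" if "H #> x = H" by (rule coset_join1[OF that x subgroup_axioms])
qed

lemma (in normal) coset_hom: "group_hom G (G Mod H) (\<lambda>a. H #> a)"
  by (intro group_hom.intro group_hom_axioms.intro r_coset_hom_Mod factorgroup_is_group group_axioms)

lemma (in group) commutator_eq_one_iff:
  assumes x: "x \<in> carrier G" and y: "y \<in> carrier G"
  shows "commutator G x y = \<one> \<longleftrightarrow> x \<otimes> y = y \<otimes> x"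
proof -
  have e: "commutator G x y = inv (y \<otimes> x) \<otimes> (x \<otimes> y)"
    using x y by (simp add: commutator_def inv_mult_group m_assoc)
  have "inv (y \<otimes> x) \<otimes> (x \<otimes> y) = \<one> \<longleftrightarrow> x \<otimes> y = (y \<otimes> x) \<otimes> \<one>"
    using x y by (metis inv_closed inv_solve_left m_closed one_closed)
  then show ?thesis using x y by (simp add: e)
qed

lemma (in normal) commutator_mem_iff:
  assumes "x \<in> carrier G" "y \<in> carrier G"
  shows "commutator G x y \<in> H \<longleftrightarrow> H #> (x \<otimes> y) = H #> (y \<otimes> x)"
proof -
  interpret Q: group_hom G "G Mod H" "\<lambda>a. H #> a" by (rule coset_hom)
  have "commutator G x y \<in> H \<longleftrightarrow> commutator (G Mod H) (H #> x) (H #> y) = \<one>\<^bsub>G Mod H\<^esub>"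
    using assms mem_iff_coset[of "commutator G x y"] Q.hom_commutator[OF assms] by simp
  then show ?thesis
    using assms Q.hom_mult[OF assms] Q.hom_mult[OF assms(2,1)]
    by (metis Q.H.commutator_eq_one_iff Q.hom_closed)
qed

text \<open>The elements that commute modulo C with a fixed set form a subgroup, so commuting modulo
  C passes from generators to generated subgroups, one argument at a time. No commutator expansion
  is required.\<close>

lemma (in group) commutator_generate:
  assumes C: "C \<lhd> G" and A: "A \<subseteq> carrier G" and S: "S \<subseteq> carrier G"
    and AS: "\<And>a s. a \<in> A \<Longrightarrow> s \<in> S \<Longrightarrow> commutator G a s \<in> C"
    and a: "a \<in> generate G A" and s: "s \<in> generate G S"
  shows "commutator G a s \<in> C"
proof -
  interpret C: normal C G by (rule C)
  interpret Q: group_hom G "G Mod C" "\<lambda>a. C #> a" by (rule C.coset_hom)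
  have sub: "subgroup {x \<in> carrier G. \<forall>y\<in>Y. C #> (x \<otimes> y) = C #> (y \<otimes> x)} G"
    if Y: "Y \<subseteq> carrier G" for Y
  proof (rule subgroupI)
    fix x x' assume x: "x \<in> {x \<in> carrier G. \<forall>y\<in>Y. C #> (x \<otimes> y) = C #> (y \<otimes> x)}"
      and x': "x' \<in> {x \<in> carrier G. \<forall>y\<in>Y. C #> (x \<otimes> y) = C #> (y \<otimes> x)}"
    have "C #> (x \<otimes> x' \<otimes> y) = C #> (y \<otimes> (x \<otimes> x'))" if "y \<in> Y" for y
    proof -
      have c: "x \<in> carrier G" "x' \<in> carrier G" "y \<in> carrier G" using x x' that Y by auto
      have e: "C #> (x \<otimes> y) = C #> (y \<otimes> x)" "C #> (x' \<otimes> y) = C #> (y \<otimes> x')" using x x' that by auto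
      have "C #> (x \<otimes> x' \<otimes> y) = (C #> x) \<otimes>\<^bsub>G Mod C\<^esub> (C #> (x' \<otimes> y))"
        using c Q.hom_mult[of x "x' \<otimes> y"] by (simp add: m_assoc)
      also have "\<dots> = (C #> (x \<otimes> y)) \<otimes>\<^bsub>G Mod C\<^esub> (C #> x')"
        using c e Q.hom_mult[of x "y \<otimes> x'"] Q.hom_mult[of "x \<otimes> y" x'] by (simp add: m_assoc)
      also have "\<dots> = C #> (y \<otimes> (x \<otimes> x'))"
        using c e Q.hom_mult[of "y \<otimes> x" x'] by (simp add: m_assoc)
      finally show ?thesis .
    qed
    then show "x \<otimes> x' \<in> {x \<in> carrier G. \<forall>y\<in>Y. C #> (x \<otimes> y) = C #> (y \<otimes> x)}" using x x' by auto
    have "C #> (inv x \<otimes> y) = C #> (y \<otimes> inv x)" if "y \<in> Y" for y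
    proof -
      have c: "x \<in> carrier G" "y \<in> carrier G" using x that Y by auto
      have e: "C #> (x \<otimes> y) = C #> (y \<otimes> x)" using x that by auto
      have "C #> (inv x \<otimes> y) = (C #> inv x) \<otimes>\<^bsub>G Mod C\<^esub> (C #> (y \<otimes> x)) \<otimes>\<^bsub>G Mod C\<^esub> (C #> inv x)"
        using c Q.hom_mult[of "inv x" "y \<otimes> x"] Q.hom_mult[of "inv x \<otimes> (y \<otimes> x)" "inv x"]
        by (simp add: m_assoc)
      also have "\<dots> = (C #> inv x) \<otimes>\<^bsub>G Mod C\<^esub> (C #> (x \<otimes> y)) \<otimes>\<^bsub>G Mod C\<^esub> (C #> inv x)"
        by (simp only: e)
      also have "\<dots> = C #> (y \<otimes> inv x)"
        using c Q.hom_mult[of "inv x" "x \<otimes> y"] Q.hom_mult[of "inv x \<otimes> (x \<otimes> y)" "inv x"]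
        by (simp flip: m_assoc)
      finally show ?thesis .
    qed
    then show "inv x \<in> {x \<in> carrier G. \<forall>y\<in>Y. C #> (x \<otimes> y) = C #> (y \<otimes> x)}" using x by auto
  qed (use Y in \<open>auto intro!: exI[of _ \<one>]\<close>)
  have "generate G A \<subseteq> {x \<in> carrier G. \<forall>y\<in>S. C #> (x \<otimes> y) = C #> (y \<otimes> x)}"
  proof (rule generate_subgroup_incl[OF _ sub[OF S]], clarify)
    fix a assume a: "a \<in> A"
    have "C #> (a \<otimes> y) = C #> (y \<otimes> a)" if "y \<in> S" for y
      using C.commutator_mem_iff[of a y] AS[OF a that] a that A S by blast
    then show "a \<in> carrier G \<and> (\<forall>y\<in>S. C #> (a \<otimes> y) = C #> (y \<otimes> a))"
      using a A by blast
  qed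
  \<comment> \<open>The roles are exchanged: the fixed set is now the subgroup generated by A, and
    the same subgroup argument is applied to S.\<close>
  then have "S \<subseteq> {x \<in> carrier G. \<forall>y\<in>generate G A. C #> (x \<otimes> y) = C #> (y \<otimes> x)}"
    using S by auto
  then have "generate G S \<subseteq> {x \<in> carrier G. \<forall>y\<in>generate G A. C #> (x \<otimes> y) = C #> (y \<otimes> x)}"
    by (rule generate_subgroup_incl[OF _ sub[OF generate_incl[OF A]]])
  then show ?thesis
    using a s generate_incl[OF A] C.commutator_mem_iff[of a s] by blast
qed

text \<open>Used in a quotient, where s and t are the perturbations of the two entries. The proof
  compares both commutators through the identity y x [x,y] = x y.\<close>

lemma (in group) commutator_mult_commuting:
  assumes "a \<in> carrier G" "b \<in> carrier G" "s \<in> carrier G" "t \<in> carrier G"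
    and sb: "s \<otimes> b = b \<otimes> s" and st: "s \<otimes> t = t \<otimes> s" and ta: "a \<otimes> t = t \<otimes> a"
  shows "commutator G (s \<otimes> a) (t \<otimes> b) = commutator G a b"
proof -
  have "(t \<otimes> b) \<otimes> (s \<otimes> a) \<otimes> commutator G a b = (s \<otimes> a) \<otimes> (t \<otimes> b)"
  proof -
    have "(t \<otimes> b) \<otimes> (s \<otimes> a) \<otimes> commutator G a b = t \<otimes> (b \<otimes> s) \<otimes> (a \<otimes> (inv a \<otimes> (inv b \<otimes> (a \<otimes> b))))"
      using assms(1-4) by (simp add: commutator_def m_assoc)
    also have "\<dots> = t \<otimes> (s \<otimes> b) \<otimes> (inv b \<otimes> (a \<otimes> b))"
      using assms(1-4) by (simp add: sb m_assoc[symmetric])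
    also have "\<dots> = t \<otimes> s \<otimes> (b \<otimes> inv b) \<otimes> a \<otimes> b"
      using assms(1-4) by (simp only: m_assoc m_closed inv_closed)
    also have "\<dots> = s \<otimes> (t \<otimes> a) \<otimes> b"
      using assms(1-4) by (simp add: st[symmetric] m_assoc)
    also have "\<dots> = (s \<otimes> a) \<otimes> (t \<otimes> b)"
      using assms(1-4) by (simp add: ta[symmetric] m_assoc)
    finally show ?thesis .
  qed
  moreover have "(t \<otimes> b) \<otimes> (s \<otimes> a) \<otimes> commutator G (s \<otimes> a) (t \<otimes> b) = (s \<otimes> a) \<otimes> (t \<otimes> b)"
  proof -
    have "y \<otimes> x \<otimes> commutator G x y = x \<otimes> y" if "x \<in> carrier G" "y \<in> carrier G" for x y
      using that by (simp add: commutator_def m_assoc[symmetric])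
        (simp add: m_assoc that)
    then show ?thesis using assms(1-4) by simp
  qed
  ultimately show ?thesis
    using assms(1-4) by (metis m_closed commutator_closed inv_solve_left)
qed

section \<open>Word values and cosets of a normal subgroup\<close>

lemma (in group) word_values_conj:
  assumes "x \<in> word_values {v} G" "g \<in> carrier G"
  shows "g \<otimes> x \<otimes> inv g \<in> word_values {v} G"
proof -
  have "(\<lambda>x. g \<otimes> x \<otimes> inv g) \<in> hom G G"
    by (rule homI) (use assms(2) in \<open>simp_all add: m_assoc inv_solve_left\<close>)
  then interpret c: group_hom G G "\<lambda>x. g \<otimes> x \<otimes> inv g"
    by (simp add: group_hom_def group_hom_axioms_def is_group)
  obtain e where e: "x = word_eval G e v" "\<forall>i. e i \<in> carrier G"
    using assms(1) by (auto simp: word_values_single)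
  then have "g \<otimes> x \<otimes> inv g = word_eval G (\<lambda>i. g \<otimes> e i \<otimes> inv g) v"
    using c.hom_word_eval[of e v] by simp
  then show ?thesis
    using e(2) c.hom_closed unfolding word_values_single by blast
qed

lemma (in group) verbal_subgroup_normal: "verbal_subgroup {v} G \<lhd> G"
  unfolding verbal_subgroup_def
  by (rule normal_generateI[OF word_values_carrier]) (rule word_values_conj)

lemma (in group) generate_word_values_Int_normal:
  assumes "R \<lhd> G"
  shows "generate G (word_values {v} G \<inter> R) \<lhd> G"
proof (rule normal_generateI)
  show "word_values {v} G \<inter> R \<subseteq> carrier G" using word_values_carrier by auto
  show "g \<otimes> h \<otimes> inv g \<in> word_values {v} G \<inter> R"
    if "h \<in> word_values {v} G \<inter> R" "g \<in> carrier G" for g h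
    using that word_values_conj assms by (auto simp: normal_inv_iff)
qed

text \<open>Base case of the inductions on words: every element is a value of a variable, so the
  values in R exhaust R.\<close>

lemma (in group) generate_word_values_Int_Var:
  assumes "subgroup R G"
  shows "generate G (word_values {Var i} G \<inter> R) = R"
proof -
  have "x \<in> word_values {Var i} G" if "x \<in> carrier G" for x
    using that by (auto simp: word_values_single intro!: exI[of _ "\<lambda>_. x"])
  then have "word_values {Var i} G \<inter> R = R"
    using subgroup.subset[OF assms] by auto
  then show ?thesis
    using generateI[OF assms subset_refl] assms by (metis generate_subgroup_incl generate.incl subsetI subset_antisym subset_refl)
qed

text \<open>A commutator with one entry in the normal subgroup R lies in R. Hence a value of one
  factor that lies in R, commuted with any value of the other, is a value of \<open>Comm u v\<close>
  in R; passing to generated subgroups is \<open>commutator_generate\<close>.\<close>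

lemma (in group) commutator_word_values_Int:
  assumes disj: "word_vars u \<inter> word_vars v = {}" and R: "R \<lhd> G"
  shows "s \<in> generate G (word_values {u} G \<inter> R) \<Longrightarrow> b \<in> verbal_subgroup {v} G \<Longrightarrow>
      commutator G s b \<in> generate G (word_values {Comm u v} G \<inter> R)"
    and "a \<in> verbal_subgroup {u} G \<Longrightarrow> t \<in> generate G (word_values {v} G \<inter> R) \<Longrightarrow>
      commutator G a t \<in> generate G (word_values {Comm u v} G \<inter> R)"
proof -
  interpret R: normal R G by (rule R)
  have R1: "commutator G s b \<in> R" if "s \<in> R" "b \<in> carrier G" for s b
  proof -
    have "inv b \<otimes> s \<otimes> b \<in> R" using R.inv_op_closed1 that by blast
    then show ?thesis using that R.mem_carrier[OF that(1)] by (simp add: commutator_def m_assoc)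
  qed
  have R2: "commutator G a t \<in> R" if "t \<in> R" "a \<in> carrier G" for a t
  proof -
    have "inv a \<otimes> inv t \<otimes> a \<in> R" using R.inv_op_closed1 that by blast
    then show ?thesis using that R.mem_carrier[OF that(1)] by (simp add: commutator_def)
  qed
  have c: "word_values {x} G \<subseteq> carrier G" "word_values {x} G \<inter> R \<subseteq> carrier G" for x
    using word_values_carrier by auto
  have "commutator G x y \<in> generate G (word_values {Comm u v} G \<inter> R)"
    if "x \<in> word_values {u} G" "y \<in> word_values {v} G" "x \<in> R \<or> y \<in> R" for x y
  proof (rule generate.incl, rule IntI)
    show "commutator G x y \<in> word_values {Comm u v} G"
      using that(1,2) by (auto simp: word_values_comm[OF disj])
    show "commutator G x y \<in> R" using that R1[of x y] R2[of y x] c(1) by auto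
  qed
  then show "s \<in> generate G (word_values {u} G \<inter> R) \<Longrightarrow> b \<in> verbal_subgroup {v} G \<Longrightarrow>
      commutator G s b \<in> generate G (word_values {Comm u v} G \<inter> R)"
    and "a \<in> verbal_subgroup {u} G \<Longrightarrow> t \<in> generate G (word_values {v} G \<inter> R) \<Longrightarrow>
      commutator G a t \<in> generate G (word_values {Comm u v} G \<inter> R)"
    unfolding verbal_subgroup_def
    using commutator_generate[OF generate_word_values_Int_normal[OF R] c(2,1), of u v "Comm u v" s b]
      commutator_generate[OF generate_word_values_Int_normal[OF R] c(1,2), of u v "Comm u v" a t]
    by auto
qed

text \<open>This says that R becomes marginal once its values are divided out. For a commutator, the
  values of u and v change by factors s and t generated by their own values in R; modulo the values
  of \<open>Comm u v\<close> in R these factors commute with everything they have to pass, so they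
  cancel.\<close>

lemma (in group) word_eval_cong_mod:
  assumes "outer_commutator_word v" and R: "R \<lhd> G"
    and "\<And>i. e i \<in> carrier G" "\<And>i. e' i \<in> carrier G"
    and "\<And>i. i \<in> word_vars v \<Longrightarrow> R #> e i = R #> e' i"
  shows "generate G (word_values {v} G \<inter> R) #> word_eval G e v
       = generate G (word_values {v} G \<inter> R) #> word_eval G e' v"
  using assms(1,5)
proof (induction v)
  case (1 i)
  then show ?case
    using R by (simp add: generate_word_values_Int_Var normal_imp_subgroup)
next
  case (2 u v)
  let ?S = "\<lambda>v. generate G (word_values {v} G \<inter> R)"
  interpret R: normal R G by (rule R)
  interpret C: normal "?S (Comm u v)" G by (rule generate_word_values_Int_normal[OF R])
  interpret Q: group_hom G "G Mod ?S (Comm u v)" "\<lambda>a. ?S (Comm u v) #> a" by (rule C.coset_hom)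
  have ev: "word_eval G f x \<in> word_values {x} G" "word_eval G f x \<in> verbal_subgroup {x} G"
      "word_eval G f x \<in> carrier G" if "\<And>i. f i \<in> carrier G" for f x
    using that by (auto simp: word_values_single verbal_subgroup_def intro!: generate.incl)
  have Sv: "?S x \<subseteq> verbal_subgroup {x} G" for x
    unfolding verbal_subgroup_def by (rule mono_generate) auto
  have Sc: "?S x \<subseteq> carrier G" for x
    using generate_incl word_values_carrier by (meson Int_lower1 order_trans)
  obtain s where s: "s \<in> ?S u" "word_eval G e' u = s \<otimes> word_eval G e u"
  proof -
    have "word_eval G e' u \<in> ?S u #> word_eval G e u"
      using 2 assms(3,4) ev Sc by (metis rcos_self generate_word_values_Int_normal[OF R] normal_imp_subgroup UnI1 word_vars.simps(2))
    then show ?thesis using that by (auto simp: r_coset_def)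
  qed
  obtain t where t: "t \<in> ?S v" "word_eval G e' v = t \<otimes> word_eval G e v"
  proof -
    have "word_eval G e' v \<in> ?S v #> word_eval G e v"
      using 2 assms(3,4) ev Sc by (metis rcos_self generate_word_values_Int_normal[OF R] normal_imp_subgroup UnI2 word_vars.simps(2))
    then show ?thesis using that by (auto simp: r_coset_def)
  qed
  let ?p = "\<lambda>a. ?S (Comm u v) #> a" and ?a = "word_eval G e u" and ?b = "word_eval G e v"
  have c: "s \<in> carrier G" "t \<in> carrier G" "?a \<in> carrier G" "?b \<in> carrier G"
    using s t Sc ev assms(3) by auto
  have comm: "?p x \<otimes>\<^bsub>G Mod ?S (Comm u v)\<^esub> ?p y = ?p y \<otimes>\<^bsub>G Mod ?S (Comm u v)\<^esub> ?p x"
    if "x \<in> carrier G" "y \<in> carrier G" "commutator G x y \<in> ?S (Comm u v)" for x y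
    using that C.commutator_mem_iff Q.hom_mult by metis
  note cw = commutator_word_values_Int[OF \<open>word_vars u \<inter> word_vars v = {}\<close> R]
  have "commutator G s ?b \<in> ?S (Comm u v)" "commutator G s t \<in> ?S (Comm u v)"
      "commutator G ?a t \<in> ?S (Comm u v)"
    using cw(1)[OF s(1) ev(2)] cw(1)[OF s(1) subsetD[OF Sv t(1)]] cw(2)[OF ev(2) t(1)] assms(3)
    by auto
  note comm' = comm[OF c(1,4) this(1)] comm[OF c(1,2) this(2)] comm[OF c(3,2) this(3)]
  have "commutator (G Mod ?S (Comm u v)) (?p s \<otimes>\<^bsub>G Mod ?S (Comm u v)\<^esub> ?p ?a)
      (?p t \<otimes>\<^bsub>G Mod ?S (Comm u v)\<^esub> ?p ?b) = commutator (G Mod ?S (Comm u v)) (?p ?a) (?p ?b)"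
    by (rule Q.H.commutator_mult_commuting[OF Q.hom_closed[OF c(3)] Q.hom_closed[OF c(4)]
          Q.hom_closed[OF c(1)] Q.hom_closed[OF c(2)] comm'])
  then show ?case
    using c by (simp add: s t Q.hom_commutator Q.hom_mult)
qed

text \<open>Conjugation by an element of R keeps every argument in its coset of R, so by
  \<open>word_eval_cong_mod\<close> it fixes each value modulo the values in R.\<close>

lemma (in group) normal_commutes_verbal_mod:
  assumes "outer_commutator_word v" and R: "R \<lhd> G"
    and "x \<in> verbal_subgroup {v} G" and "r \<in> R"
  shows "commutator G x r \<in> generate G (word_values {v} G \<inter> R)"
proof -
  interpret R: normal R G by (rule R)
  interpret C: normal "generate G (word_values {v} G \<inter> R)" G
    by (rule generate_word_values_Int_normal[OF R])
  have "commutator G t r \<in> generate G (word_values {v} G \<inter> R)"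
    if t: "t \<in> word_values {v} G" and r: "r \<in> R" for t r
  proof -
    obtain e where e: "t = word_eval G e v" "\<And>i. e i \<in> carrier G"
      using t by (auto simp: word_values_single)
    have rc: "r \<in> carrier G" using r by (rule R.mem_carrier)
    have "(\<lambda>x. r \<otimes> x \<otimes> inv r) \<in> hom G G"
      by (rule homI) (use rc in \<open>simp_all add: m_assoc inv_solve_left\<close>)
    then interpret c: group_hom G G "\<lambda>x. r \<otimes> x \<otimes> inv r"
      by (simp add: group_hom_def group_hom_axioms_def is_group)
    have tc: "t \<in> carrier G" using e by auto
    \<comment> \<open>The conjugate is r (e inv r inv e) e with e = \<open>e i\<close>, and the
      factor in front of the last e lies in R.\<close>
    have "R #> e i = R #> (r \<otimes> e i \<otimes> inv r)" for i
    proof -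
      have "e i \<otimes> inv r \<otimes> inv (e i) \<in> R" using R.inv_op_closed2 r e(2) by auto
      then have "r \<otimes> (e i \<otimes> inv r \<otimes> inv (e i)) \<in> R" using r by auto
      then have "R #> (r \<otimes> (e i \<otimes> inv r \<otimes> inv (e i))) = R"
        by (metis R.mem_carrier R.mem_iff_coset)
      then have "R #> e i = R #> (r \<otimes> (e i \<otimes> inv r \<otimes> inv (e i))) #> e i" by simp
      also have "\<dots> = R #> (r \<otimes> e i \<otimes> inv r)"
        using rc e(2) R.subset by (simp add: coset_mult_assoc m_assoc)
      finally show ?thesis .
    qed
    then have "generate G (word_values {v} G \<inter> R) #> t
        = generate G (word_values {v} G \<inter> R) #> (r \<otimes> t \<otimes> inv r)"
      using word_eval_cong_mod[OF assms(1) R, of e "\<lambda>i. r \<otimes> e i \<otimes> inv r"]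
        c.hom_word_eval[of e v] e rc by simp
    then have "generate G (word_values {v} G \<inter> R) #> t #> r
        = generate G (word_values {v} G \<inter> R) #> (r \<otimes> t \<otimes> inv r) #> r" by simp
    then have "generate G (word_values {v} G \<inter> R) #> (t \<otimes> r)
        = generate G (word_values {v} G \<inter> R) #> (r \<otimes> t)"
      using tc rc C.subset by (simp add: coset_mult_assoc m_assoc)
    then show ?thesis using C.commutator_mem_iff tc rc by simp
  qed
  then show ?thesis
    using commutator_generate[OF C.normal_axioms word_values_carrier R.subset]
      assms(3,4) generate.incl unfolding verbal_subgroup_def by metis
qed

section \<open>Verbal subgroups modulo trivial values\<close>

lemma finite_image_factor:
  assumes "finite (g ` A)" and eq: "\<And>x y. x \<in> A \<Longrightarrow> y \<in> A \<Longrightarrow> g x = g y \<Longrightarrow> f x = f y"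
  shows "finite (f ` A)"
proof (rule finite_surj[OF assms(1)])
  show "f ` A \<subseteq> (\<lambda>c. f (inv_into A g c)) ` g ` A"
  proof (rule image_subsetI)
    fix x assume x: "x \<in> A"
    then have "g x \<in> g ` A" by (rule imageI)
    then have "f x = f (inv_into A g (g x))"
      by (intro eq x inv_into_into f_inv_into_f[symmetric])
    then show "f x \<in> (\<lambda>c. f (inv_into A g c)) ` g ` A"
      using \<open>g x \<in> g ` A\<close> by (rule image_eqI)
  qed
qed

section \<open>Powers of commutators\<close>

lemma (in group) conj_pow:
  assumes "x \<in> carrier G" "b \<in> carrier G"
  shows "(inv b \<otimes> x \<otimes> b) [^] (n::nat) = inv b \<otimes> x [^] n \<otimes> b"
proof (induction n)
  case (Suc n)
  have "(inv b \<otimes> x \<otimes> b) [^] Suc n = inv b \<otimes> x [^] n \<otimes> (b \<otimes> inv b) \<otimes> x \<otimes> b"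
    using Suc assms by (simp only: nat_pow_Suc m_assoc m_closed inv_closed nat_pow_closed)
  then show ?case using assms by (simp add: m_assoc)
qed (use assms in simp)

lemma (in group) commutator_mult_right:
  assumes "a \<in> carrier G" "b \<in> carrier G" "c \<in> carrier G"
  shows "commutator G a (b \<otimes> c) = commutator G a c \<otimes> (inv c \<otimes> commutator G a b \<otimes> c)"
proof -
  have "x \<otimes> (inv x \<otimes> y) = y" if "x \<in> carrier G" "y \<in> carrier G" for x y
    using that by (simp flip: m_assoc)
  then show ?thesis
    using assms by (simp add: commutator_def inv_mult_group m_assoc)
qed

text \<open>Expanding [a, b^j] gives j conjugates of [a,b] under powers of b. Put M = m k1: M-th
  powers are multiplicative on L, and they are k1-th powers of elements of L, so they absorb
  conjugation by b. Thus [a, b^j]^M = [a,b]^(M j), and j = k2 kills the generators of L.\<close>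

lemma (in group) bounded_exponent_commutators:
  fixes m k1 k2 :: nat
  assumes L: "L \<lhd> G" and A: "A \<subseteq> carrier G" and D: "D \<subseteq> carrier G"
    and gen: "L = generate G {commutator G a b | a b. a \<in> A \<and> b \<in> D}"
    and hom: "\<And>x y j. x \<in> L \<Longrightarrow> y \<in> L \<Longrightarrow> (x \<otimes> y) [^] (m * j) = x [^] (m * j) \<otimes> y [^] (m * j)"
    and k1: "\<And>c b. c \<in> L \<Longrightarrow> b \<in> D \<Longrightarrow> c [^] k1 \<otimes> b = b \<otimes> c [^] k1"
    and k2: "\<And>a b. a \<in> A \<Longrightarrow> b \<in> D \<Longrightarrow> commutator G a (b [^] k2) = \<one>"
    and x: "x \<in> L"
  shows "x [^] (m * k1 * k2) = \<one>"
proof -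
  interpret L: normal L G by (rule L)
  define M where "M = m * k1"
  have hom': "(x \<otimes> y) [^] (M * j) = x [^] (M * j) \<otimes> y [^] (M * j)" if "x \<in> L" "y \<in> L" for x y j
    using hom[OF that, of "k1 * j"] by (simp add: M_def mult.assoc)
  have inL: "commutator G a b \<in> L" if "a \<in> A" "b \<in> D" for a b
    unfolding gen by (rule generate.incl) (use that in auto)
  have M: "(inv b \<otimes> c \<otimes> b) [^] M = c [^] M" if c: "c \<in> L" and b: "b \<in> D" for b c
  proof -
    have cc: "c \<in> carrier G" "b \<in> carrier G" using c b D L.mem_carrier by auto
    have "c [^] M \<otimes> b = b \<otimes> c [^] M"
      using k1[OF subgroup_nat_pow_closed[OF L.subgroup_axioms c] b] cc by (simp add: M_def nat_pow_pow)
    then show ?thesis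
      using cc by (metis conj_pow inv_closed l_inv l_one m_assoc nat_pow_closed)
  qed
  have pow: "commutator G a (b [^] j) \<in> L \<and> commutator G a (b [^] j) [^] M = commutator G a b [^] (M * j)"
    if a: "a \<in> A" and b: "b \<in> D" for a b and j :: nat
  proof (induction j)
    case 0
    then show ?case using a b A D by (auto simp: commutator_def)
  next
    case (Suc j)
    have c: "a \<in> carrier G" "b \<in> carrier G" using a b A D by auto
    have e: "commutator G a (b [^] Suc j) = commutator G a b \<otimes> (inv b \<otimes> commutator G a (b [^] j) \<otimes> b)"
      using commutator_mult_right[OF c(1) nat_pow_closed[OF c(2)] c(2)] by simp
    have i: "inv b \<otimes> commutator G a (b [^] j) \<otimes> b \<in> L"
      using Suc c L.inv_op_closed1 by blast
    have "commutator G a (b [^] Suc j) [^] M = commutator G a b [^] M \<otimes> commutator G a (b [^] j) [^] M"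
      unfolding e using hom'[OF inL[OF a b] i, of 1] M[OF _ b] Suc by simp
    also have "\<dots> = commutator G a b [^] (M * Suc j)"
      using Suc c by (simp add: nat_pow_mult)
    finally show ?case using i inL[OF a b] by (simp only: e L.m_closed simp_thms)
  qed
  have gens: "commutator G a b [^] (M * k2) = \<one>" if "a \<in> A" "b \<in> D" for a b
    using pow[OF that, of k2] k2[OF that] by simp
  have "x \<in> L \<and> x [^] (M * k2) = \<one>"
    using x unfolding gen
  proof (induction rule: generate.induct)
    case one
    then show ?case using generate.one by auto
  next
    case (incl h)
    then have "h [^] (M * k2) = \<one>" using gens by auto
    then show ?case using generate.incl[OF incl] by simp
  next
    case (inv h)
    then have "h [^] (M * k2) = \<one>" "h \<in> carrier G" using gens A D by auto
    then show ?case using generate.inv[OF inv] by (simp add: nat_pow_inv)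
  next
    case (eng h1 h2)
    then show ?case using hom'[of h1 h2 k2] generate.eng by (auto simp: gen)
  qed
  then show ?thesis by (simp add: M_def)
qed

text \<open>In the induction step for \<open>Comm u v\<close>, \<open>k1\<close>-th powers from the verbal subgroup of \<open>u\<close> commute
  with the values of \<open>v\<close> modulo the trivial values, and vice versa for \<open>k2\<close>; a suitable power map is a
  homomorphism because \<open>R\<close> meets the verbal subgroup in a subgroup that is central there and of finite
  index.\<close>

theorem (in group) verbal_subgroup_bounded_exponent:
  assumes "outer_commutator_word v" and R: "R \<lhd> G" and fin: "finite (rcosets R)"
  shows "\<exists>k::nat. k > 0 \<and>
    (\<forall>x\<in>verbal_subgroup {v} G. x [^] k \<in> generate G (word_values {v} G \<inter> R))"
  using assms(1)
proof (induction v)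
  case (1 i)
  have "card (rcosets R) > 0"
    using fin subgroup.subgroup_in_rcosets[OF normal_imp_subgroup[OF R] is_group]
    by (auto simp: card_gt_0_iff)
  moreover have "verbal_subgroup {Var i} G \<subseteq> carrier G"
    unfolding verbal_subgroup_def by (rule generate_incl[OF word_values_carrier])
  ultimately show ?case
    using power_in_normal_of_finite_index[OF R fin] R
    by (auto simp: generate_word_values_Int_Var normal_imp_subgroup)
next
  case (2 u v)
  let ?S = "\<lambda>v. generate G (word_values {v} G \<inter> R)"
  let ?C = "?S (Comm u v)" and ?V = "verbal_subgroup {Comm u v} G"
  let ?Q = "G Mod ?C" and ?p = "\<lambda>a. ?C #> a"
  have outer: "outer_commutator_word (Comm u v)"
    using 2 by (auto intro: outer_commutator_word.intros)
  obtain k1 :: nat where k1: "k1 > 0" "\<And>x. x \<in> verbal_subgroup {u} G \<Longrightarrow> x [^] k1 \<in> ?S u"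
    using "2.IH"(1) by auto
  obtain k2 :: nat where k2: "k2 > 0" "\<And>x. x \<in> verbal_subgroup {v} G \<Longrightarrow> x [^] k2 \<in> ?S v"
    using "2.IH"(2) by auto
  interpret R: normal R G by (rule R)
  interpret C: normal ?C G by (rule generate_word_values_Int_normal[OF R])
  interpret V: normal ?V G by (rule verbal_subgroup_normal)
  interpret U: normal "verbal_subgroup {u} G" G by (rule verbal_subgroup_normal)
  interpret Q: group_hom G ?Q ?p by (rule C.coset_hom)
  have tv: "word_values {x} G \<subseteq> verbal_subgroup {x} G" for x
    unfolding verbal_subgroup_def by (auto intro: generate.incl)
  note wv = word_values_comm[OF \<open>word_vars u \<inter> word_vars v = {}\<close>]
  note cw = commutator_word_values_Int[OF \<open>word_vars u \<inter> word_vars v = {}\<close> R]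
  \<comment> \<open>Since [a,b] is inv a times a conjugate of a, it stays in the normal subgroup
    belonging to u. This makes the exponent k1, obtained for u, available for elements of
    \<open>?V\<close>.\<close>
  have VU: "?V \<subseteq> verbal_subgroup {u} G"
    unfolding verbal_subgroup_def[of "{Comm u v}"]
  proof (rule generate_subgroup_incl[OF _ U.subgroup_axioms], clarsimp simp: wv)
    fix a b assume a: "a \<in> word_values {u} G" and b: "b \<in> word_values {v} G"
    then have "a \<in> verbal_subgroup {u} G" "b \<in> carrier G" using tv word_values_carrier by auto
    then have "inv a \<otimes> (inv b \<otimes> a \<otimes> b) \<in> verbal_subgroup {u} G"
      using U.inv_op_closed1 by auto
    then show "commutator G a b \<in> verbal_subgroup {u} G"
      using \<open>b \<in> carrier G\<close> \<open>a \<in> verbal_subgroup {u} G\<close> U.mem_carrier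
      by (simp add: commutator_def m_assoc)
  qed
  have comm: "?p x \<otimes>\<^bsub>?Q\<^esub> ?p y = ?p y \<otimes>\<^bsub>?Q\<^esub> ?p x"
    if "x \<in> carrier G" "y \<in> carrier G" "commutator G x y \<in> ?C" for x y
    using that C.commutator_mem_iff Q.hom_mult by metis
  let ?L = "?p ` ?V" and ?Z = "?p ` (?V \<inter> R)"
  have img: "(h ` N) \<lhd> ?Q" if "N \<lhd> G" and "h = ?p" for N h
  proof (rule Q.H.normal_invI)
    show "subgroup (h ` N) ?Q"
      using that Q.subgroup_img_is_subgroup normal_imp_subgroup by blast
    show "g \<otimes>\<^bsub>?Q\<^esub> h' \<otimes>\<^bsub>?Q\<^esub> inv\<^bsub>?Q\<^esub> g \<in> h ` N" if g: "g \<in> carrier ?Q" and h': "h' \<in> h ` N" for g h'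
    proof -
      obtain g0 where g0: "g0 \<in> carrier G" "g = ?p g0" using g by (auto simp: carrier_FactGroup)
      obtain n where n: "n \<in> N" "h' = ?p n" using h' \<open>h = ?p\<close> by auto
      then have "g0 \<otimes> n \<otimes> inv g0 \<in> N" using \<open>N \<lhd> G\<close> g0 by (simp add: normal_inv_iff)
      moreover have nc: "n \<in> carrier G" using n \<open>N \<lhd> G\<close> by (meson normal_imp_subgroup subgroup.mem_carrier)
      have "g \<otimes>\<^bsub>?Q\<^esub> h' \<otimes>\<^bsub>?Q\<^esub> inv\<^bsub>?Q\<^esub> g = ?p (g0 \<otimes> n \<otimes> inv g0)"
        unfolding g0(2) n(2) using g0(1) nc
        by (metis Q.hom_inv Q.hom_mult inv_closed m_closed)
      ultimately show ?thesis using \<open>h = ?p\<close> by blast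
    qed
  qed
  have L: "?L \<lhd> ?Q" using img[OF V.normal_axioms refl] .
  let ?QL = "?Q\<lparr>carrier := ?L\<rparr>"
  interpret QL: group ?QL
    by (rule subgroup.subgroup_is_group[OF normal_imp_subgroup[OF L] Q.H.is_group])
  have ZQ: "subgroup ?Z ?Q"
    using Q.subgroup_img_is_subgroup subgroups_Inter_pair V.subgroup_axioms R.subgroup_axioms by blast
  have Zsub: "subgroup ?Z ?QL"
    by (rule Q.H.subgroup_incl[OF ZQ normal_imp_subgroup[OF L]]) auto
  have rz: "rcosets\<^bsub>?QL\<^esub> ?Z = (\<lambda>x. ?Z #>\<^bsub>?Q\<^esub> ?p x) ` ?V"
    by (auto simp: RCOSETS_def r_coset_def)
  \<comment> \<open>Elements of \<open>?V\<close> in the same coset of R differ by an element of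
    \<open>?V \<inter> R\<close>, so the index is bounded by that of R.\<close>
  have "finite ((\<lambda>x. ?Z #>\<^bsub>?Q\<^esub> ?p x) ` ?V)"
  proof (rule finite_image_factor)
    show "finite ((\<lambda>x. R #> x) ` ?V)"
      by (rule finite_subset[OF _ fin]) (auto simp: RCOSETS_def intro!: bexI V.mem_carrier)
    fix x y assume x: "x \<in> ?V" and y: "y \<in> ?V" and e: "R #> x = R #> y"
    have c: "x \<in> carrier G" "y \<in> carrier G" using x y by auto
    have "x \<otimes> inv y \<in> R"
      using e c by (metis R.rcos_module_imp R.subgroup_axioms is_group rcos_self)
    moreover have "x \<otimes> inv y \<in> ?V" using x y by blast
    ultimately have z: "?p (x \<otimes> inv y) \<in> ?Z" by blast
    have "?p x = ?p (x \<otimes> inv y) \<otimes>\<^bsub>?Q\<^esub> ?p y"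
      using c Q.hom_mult[of "x \<otimes> inv y" y] by (simp add: m_assoc)
    then have "?Z #>\<^bsub>?Q\<^esub> ?p x = ?Z #>\<^bsub>?Q\<^esub> (?p (x \<otimes> inv y) \<otimes>\<^bsub>?Q\<^esub> ?p y)"
      by (rule arg_cong)
    also have "\<dots> = ?Z #>\<^bsub>?Q\<^esub> ?p (x \<otimes> inv y) #>\<^bsub>?Q\<^esub> ?p y"
      by (rule Q.H.coset_mult_assoc[symmetric, OF subgroup.subset[OF ZQ]])
         (use c in \<open>auto simp del: Q.hom_mult intro: Q.hom_closed\<close>)
    also have "?Z #>\<^bsub>?Q\<^esub> ?p (x \<otimes> inv y) = ?Z"
      by (rule Q.H.coset_join2[OF _ ZQ z]) (use c Q.hom_closed[of "x \<otimes> inv y"] in simp)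
    finally show "?Z #>\<^bsub>?Q\<^esub> ?p x = ?Z #>\<^bsub>?Q\<^esub> ?p y" .
  qed
  then have Zfin: "finite (rcosets\<^bsub>?QL\<^esub> ?Z)" by (simp only: rz)
  have Zc: "z \<otimes>\<^bsub>?Q\<^esub> x = x \<otimes>\<^bsub>?Q\<^esub> z" if "z \<in> ?Z" "x \<in> ?L" for z x
    using that comm normal_commutes_verbal_mod[OF outer R] V.mem_carrier by force
  from QL.central_power_hom[OF Zsub Zfin] Zc obtain m :: nat where m: "m > 0"
      "(\<lambda>x. x [^]\<^bsub>?QL\<^esub> m) \<in> hom ?QL (?QL\<lparr>carrier := ?Z\<rparr>)"
    by auto
  have mZ: "x [^]\<^bsub>?Q\<^esub> m \<in> ?Z" if "x \<in> ?L" for x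
    using hom_in_carrier[OF m(2), of x] that Q.H.nat_pow_consistent[of x m ?L] by simp
  \<comment> \<open>The m-th powers of x and y lie in \<open>?Z\<close>, which is central in
    \<open>?L\<close>; so they commute, and a further j-th power distributes over their
    product.\<close>
  have mh: "(x \<otimes>\<^bsub>?Q\<^esub> y) [^]\<^bsub>?Q\<^esub> (m * j) = x [^]\<^bsub>?Q\<^esub> (m * j) \<otimes>\<^bsub>?Q\<^esub> y [^]\<^bsub>?Q\<^esub> (m * j)"
    if x: "x \<in> ?L" and y: "y \<in> ?L" for x y j
  proof -
    have c: "x \<in> carrier ?Q" "y \<in> carrier ?Q"
      using x y Q.hom_closed V.mem_carrier by blast+
    have yL: "y [^]\<^bsub>?Q\<^esub> m \<in> ?L" using mZ[OF y] by auto
    have "(x \<otimes>\<^bsub>?Q\<^esub> y) [^]\<^bsub>?Q\<^esub> m = x [^]\<^bsub>?Q\<^esub> m \<otimes>\<^bsub>?Q\<^esub> y [^]\<^bsub>?Q\<^esub> m"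
      using hom_mult[OF m(2), of x y] x y
      by (simp flip: Q.H.nat_pow_consistent)
    moreover have "(x [^]\<^bsub>?Q\<^esub> m \<otimes>\<^bsub>?Q\<^esub> y [^]\<^bsub>?Q\<^esub> m) [^]\<^bsub>?Q\<^esub> j
        = (x [^]\<^bsub>?Q\<^esub> m) [^]\<^bsub>?Q\<^esub> j \<otimes>\<^bsub>?Q\<^esub> (y [^]\<^bsub>?Q\<^esub> m) [^]\<^bsub>?Q\<^esub> j"
      by (rule Q.H.pow_mult_distrib[OF Zc[OF mZ[OF x] yL]]) (use c in auto)
    ultimately show ?thesis
      using c by (metis Q.H.m_closed Q.H.nat_pow_pow)
  qed
  let ?A = "?p ` word_values {u} G" and ?D = "?p ` word_values {v} G"
  have gen: "?L = generate ?Q {commutator ?Q a b | a b. a \<in> ?A \<and> b \<in> ?D}"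
  proof -
    have "?L = generate ?Q (?p ` word_values {Comm u v} G)"
      unfolding verbal_subgroup_def by (rule Q.generate_img[OF word_values_carrier, symmetric])
    also have "?p ` word_values {Comm u v} G = {commutator ?Q a b | a b. a \<in> ?A \<and> b \<in> ?D}"
    proof -
      have "?p (commutator G a b) = commutator ?Q (?p a) (?p b)"
        if "a \<in> word_values {u} G" "b \<in> word_values {v} G" for a b
        using Q.hom_commutator[of a b] that word_values_carrier by blast
      then show ?thesis unfolding wv by (auto simp: image_iff) metis+
    qed
    finally show ?thesis .
  qed
  have exp: "x [^]\<^bsub>?Q\<^esub> (m * k1 * k2) = \<one>\<^bsub>?Q\<^esub>" if "x \<in> ?L" for x
  proof (rule Q.H.bounded_exponent_commutators[OF L _ _ gen mh _ _ that])
    show "?A \<subseteq> carrier ?Q" "?D \<subseteq> carrier ?Q"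
      using Q.hom_closed word_values_carrier by blast+
    show "c [^]\<^bsub>?Q\<^esub> k1 \<otimes>\<^bsub>?Q\<^esub> b = b \<otimes>\<^bsub>?Q\<^esub> c [^]\<^bsub>?Q\<^esub> k1" if c: "c \<in> ?L" and b: "b \<in> ?D" for c b
    proof -
      obtain c0 b0 where c0: "c0 \<in> ?V" "c = ?p c0" "b0 \<in> word_values {v} G" "b = ?p b0"
        using c b by auto
      then have cc: "c0 \<in> carrier G" "b0 \<in> carrier G" using word_values_carrier V.mem_carrier by auto
      have "commutator G (c0 [^] k1) b0 \<in> ?C"
        using cw(1) k1(2) VU tv c0 by blast
      then show ?thesis
        using comm[of "c0 [^] k1" b0] cc by (simp add: c0 C.FactGroup_pow)
    qed
    show "commutator ?Q a (b [^]\<^bsub>?Q\<^esub> k2) = \<one>\<^bsub>?Q\<^esub>" if a: "a \<in> ?A" and b: "b \<in> ?D" for a b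
    proof -
      obtain a0 b0 where a0: "a0 \<in> word_values {u} G" "a = ?p a0" "b0 \<in> word_values {v} G" "b = ?p b0"
        using a b by auto
      then have cc: "a0 \<in> carrier G" "b0 \<in> carrier G" using word_values_carrier by auto
      have "commutator G a0 (b0 [^] k2) \<in> ?C"
        using cw(2) k2(2) tv a0 by blast
      then show ?thesis
        using Q.hom_commutator[of a0 "b0 [^] k2"] C.mem_iff_coset[of "commutator G a0 (b0 [^] k2)"] cc
        by (simp add: a0 C.FactGroup_pow)
    qed
  qed
  have "x [^] (m * k1 * k2) \<in> ?C" if "x \<in> ?V" for x
    using exp[of "?p x"] that V.mem_carrier[OF that] C.mem_iff_coset[of "x [^] (m * k1 * k2)"]
    by (simp add: C.FactGroup_pow)
  then show ?case
    using m(1) k1(1) k2(1) by (intro exI[of _ "m * k1 * k2"]) auto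
qed

section \<open>Quotients of finite abelian groups\<close>

lemma set_mult_memI: "a \<in> A \<Longrightarrow> b \<in> B \<Longrightarrow> a \<otimes>\<^bsub>G\<^esub> b \<in> A <#>\<^bsub>G\<^esub> B"
  by (auto simp: set_mult_def)

text \<open>In an abelian group the product of a finite subgroup with a finite cyclic one is again a
  finite subgroup, so the elements can be adjoined one at a time.\<close>

lemma (in comm_group) finite_subgroup_containing:
  assumes "finite A" "A \<subseteq> carrier G" and "\<And>a. a \<in> A \<Longrightarrow> \<exists>k::nat. k > 0 \<and> a [^] k = \<one>"
  shows "\<exists>M. subgroup M G \<and> finite M \<and> A \<subseteq> M"
  using assms
proof (induction A)
  case empty
  then show ?case using triv_subgroup by auto
next
  case (insert a A)
  then obtain M where M: "subgroup M G" "finite M" "A \<subseteq> M" by auto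
  have a: "a \<in> carrier G" using insert by auto
  have "ord a \<noteq> 0" using insert.prems(2)[of a] ord_eq_0[OF a] by auto
  then have f: "finite (generate G {a})"
    using generate_pow_card[OF a] by (metis card.infinite)
  have g: "subgroup (generate G {a}) G" by (rule generate_is_subgroup) (use a in simp)
  have "subgroup (M <#> generate G {a}) G" by (rule mult_subgroups[OF M(1) g])
  moreover have "finite (M <#> generate G {a})"
    using M(2) f by (simp add: set_mult_def)
  moreover have "insert a A \<subseteq> M <#> generate G {a}"
  proof
    fix b assume "b \<in> insert a A"
    then consider "b = a" | "b \<in> M" using M by auto
    then show "b \<in> M <#> generate G {a}"
    proof cases
      case 1
      have "\<one> \<otimes> a \<in> M <#> generate G {a}"
        by (rule set_mult_memI[OF subgroup.one_closed[OF M(1)] generate.incl]) simp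
      then show ?thesis using 1 a by simp
    next
      case 2
      have "b \<otimes> \<one> \<in> M <#> generate G {a}"
        by (rule set_mult_memI[OF 2 generate.one])
      then show ?thesis using 2 subgroup.mem_carrier[OF M(1)] by simp
    qed
  qed
  ultimately show ?case by blast
qed

text \<open>The exponent k is invertible modulo p, so x is itself a power of
  \<open>x [^] k\<close>.\<close>

lemma (in group) prime_order_pow_mem:
  assumes H: "subgroup H G" and x: "x \<in> carrier G" and p: "prime (p::nat)" "x [^] p = \<one>"
    and k: "x [^] k \<in> H" "\<not> p dvd k"
  shows "x \<in> H"
proof -
  have "coprime k p" using p k(2) by (metis coprime_commute prime_imp_coprime)
  moreover have "k \<noteq> 0" using k(2) by (metis dvd_0_right)
  ultimately obtain u q where u: "k * u = p * q + 1"
    using bezout_nat[of k p] by (auto simp: coprime_iff_gcd_eq_1)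
  have "(x [^] k) [^] u = (x [^] p) [^] q \<otimes> x [^] (1::nat)"
    using x by (simp only: nat_pow_pow u nat_pow_mult)
  then have "(x [^] k) [^] u = x" using p x by simp
  then show ?thesis using subgroup_nat_pow_closed[OF H k(1), of u] by simp
qed

text \<open>The complement is a subgroup maximal among those that contain all \<open>p ^ Suc h\<close>-th powers but not
  \<open>x\<close>.\<close>

lemma (in comm_group) cyclic_complement:
  assumes fin: "finite (carrier G)" and p: "prime (p::nat)"
    and y: "y \<in> carrier G" and x: "x = y [^] (p ^ h)" "x \<noteq> \<one>" "x [^] p = \<one>"
    and max: "\<And>z. z \<in> carrier G \<Longrightarrow> z [^] (p ^ Suc h) \<noteq> x"
  obtains C where "subgroup C G" "x \<notin> C"
    "\<And>g. g \<in> carrier G \<Longrightarrow> \<exists>k::nat. \<exists>c\<in>C. g = y [^] k \<otimes> c"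
proof -
  have xc: "x \<in> carrier G" using x y by simp
  define \<C> where "\<C> = {C. subgroup C G \<and> (\<forall>z\<in>carrier G. z [^] (p ^ Suc h) \<in> C) \<and> x \<notin> C}"
  have "finite \<C>"
    by (rule finite_subset[of _ "Pow (carrier G)"]) (use fin subgroup.subset in \<open>auto simp: \<C>_def\<close>)
  \<comment> \<open>The family is nonempty: the subgroup of all these powers is a first candidate,
    and by \<open>max\<close> it misses x.\<close>
  moreover have "(\<lambda>z. z [^] (p ^ Suc h)) ` carrier G \<in> \<C>"
  proof -
    have "(\<lambda>z. z [^] (p ^ Suc h)) \<in> hom G G"
      by (rule homI) (simp_all add: nat_pow_distrib del: power_Suc)
    then interpret P: group_hom G G "\<lambda>z. z [^] (p ^ Suc h)"
      by (simp add: group_hom_def group_hom_axioms_def is_group)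
    show ?thesis using P.img_is_subgroup max by (auto simp: \<C>_def simp del: power_Suc)
  qed
  ultimately obtain C where C: "C \<in> \<C>" and Cmax: "\<And>D. D \<in> \<C> \<Longrightarrow> C \<subseteq> D \<Longrightarrow> C = D"
    using finite_has_maximal[of \<C>] by (metis empty_iff)
  have Cs: "subgroup C G" and Cp: "\<And>z. z \<in> carrier G \<Longrightarrow> z [^] (p ^ Suc h) \<in> C" and Cx: "x \<notin> C"
    using C by (auto simp: \<C>_def)
  interpret C: subgroup C G by (rule Cs)
  \<comment> \<open>If g is outside C, maximality forces x = c g^i with c in C. Here p does not
    divide i, since otherwise x would lie in C. Inverting i modulo p expresses g through a power of
    x, hence of y, and an element of C.\<close>
  have root: "\<exists>k::nat. \<exists>c\<in>C. g = y [^] k \<otimes> c" if g: "g \<in> carrier G" and gp: "g [^] p \<in> C" for g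
  proof (cases "g \<in> C")
    case True
    then show ?thesis using g by (intro exI[of _ 0] bexI[of _ g]) auto
  next
    case False
    have gs: "subgroup (generate G {g}) G" by (rule generate_is_subgroup) (use g in simp)
    let ?D = "C <#> generate G {g}"
    have Ds: "subgroup ?D G" by (rule mult_subgroups[OF Cs gs])
    have CD: "C \<subseteq> ?D"
    proof
      fix c assume "c \<in> C"
      then have "c \<otimes> \<one> \<in> ?D" by (rule set_mult_memI[OF _ generate.one])
      then show "c \<in> ?D" using \<open>c \<in> C\<close> by simp
    qed
    have "g \<in> ?D"
    proof -
      have "\<one> \<otimes> g \<in> ?D" by (rule set_mult_memI[OF C.one_closed generate.incl]) simp
      then show ?thesis using g by simp
    qed
    then have "x \<in> ?D"
      using Cmax[of ?D] CD False Ds Cp by (auto simp: \<C>_def simp del: power_Suc)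
    then obtain c i where ci: "c \<in> C" "x = c \<otimes> g [^] (i::nat)"
      using generate_pow_on_finite_carrier[OF fin g] by (auto simp: set_mult_def)
    have "\<not> p dvd i"
    proof
      assume "p dvd i"
      then obtain j where "i = p * j" by auto
      then have "g [^] i \<in> C" using subgroup_nat_pow_closed[OF Cs gp, of j] g by (simp add: nat_pow_pow)
      then show False using ci Cx by auto
    qed
    then have "coprime i p" using p by (metis coprime_commute prime_imp_coprime)
    moreover have "i \<noteq> 0" using \<open>\<not> p dvd i\<close> by (metis dvd_0_right)
    ultimately obtain u q where u: "i * u = p * q + 1"
      using bezout_nat[of i p] by (auto simp: coprime_iff_gcd_eq_1)
    have "x [^] u = c [^] u \<otimes> (g [^] i) [^] u"
      using ci g by (simp add: nat_pow_distrib)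
    also have "(g [^] i) [^] u = (g [^] p) [^] q \<otimes> g [^] (1::nat)"
      using g by (simp only: nat_pow_pow u nat_pow_mult)
    finally have e: "x [^] u = (c [^] u \<otimes> (g [^] p) [^] q) \<otimes> g"
      using ci g by (simp add: m_assoc)
    let ?c = "c [^] u \<otimes> (g [^] p) [^] q"
    have cC: "?c \<in> C" using ci gp subgroup_nat_pow_closed[OF Cs] by blast
    then have cc: "?c \<in> carrier G" by auto
    have "g = x [^] u \<otimes> inv ?c"
      unfolding e using g cc by (metis inv_solve_right' m_comm m_closed)
    also have "x [^] u = y [^] (p ^ h * u)" using y by (simp add: x nat_pow_pow)
    finally show ?thesis using cC by blast
  qed
  \<comment> \<open>The induction lowers the power of p needed to enter C. From g^p = y^k c one gets
    x^k in C by taking p^h-th powers, so p divides k; dividing g by y^(k/p) gives an element whose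
    p-th power is in C, and \<open>root\<close> applies.\<close>
  have "g [^] (p ^ j) \<in> C \<Longrightarrow> j \<le> Suc h \<Longrightarrow> \<exists>k::nat. \<exists>c\<in>C. g = y [^] k \<otimes> c"
    if "g \<in> carrier G" for g j
    using that
  proof (induction j arbitrary: g)
    case 0
    then show ?case by (intro exI[of _ 0] bexI[of _ g]) auto
  next
    case (Suc j)
    have "(g [^] p) [^] (p ^ j) \<in> C" using Suc by (simp add: nat_pow_pow)
    then obtain k :: nat and c where kc: "c \<in> C" "g [^] p = y [^] k \<otimes> c"
      using Suc.IH[of "g [^] p"] Suc.prems by auto
    have cc: "c \<in> carrier G" using kc by auto
    have "g [^] (p ^ Suc h) = (g [^] p) [^] (p ^ h)" using Suc by (simp add: nat_pow_pow)
    also have "\<dots> = x [^] k \<otimes> c [^] (p ^ h)"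
      using y cc by (simp add: kc x nat_pow_distrib nat_pow_pow mult.commute)
    finally have "x [^] k \<otimes> c [^] (p ^ h) \<in> C" using Cp Suc by metis
    then have "x [^] k \<otimes> c [^] (p ^ h) \<otimes> inv (c [^] (p ^ h)) \<in> C"
      using subgroup_nat_pow_closed[OF Cs kc(1), of "p ^ h"] by blast
    then have "x [^] k \<in> C" using xc cc by (simp add: m_assoc)
    then have "p dvd k" using prime_order_pow_mem[OF Cs xc p x(3)] Cx by blast
    then obtain k' where k': "k = p * k'" by auto
    let ?g = "g \<otimes> inv (y [^] k')"
    have gc: "?g \<in> carrier G" using Suc y by auto
    have "?g [^] p = g [^] p \<otimes> inv (y [^] k)"
      using Suc.prems y by (simp add: nat_pow_distrib nat_pow_inv nat_pow_pow k' mult.commute)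
    also have "\<dots> = c" using y cc by (simp add: kc m_ac)
    finally obtain l :: nat and d where ld: "d \<in> C" "?g = y [^] l \<otimes> d"
      using root[OF gc] kc by metis
    have dc: "d \<in> carrier G" using ld by auto
    have "g = ?g \<otimes> y [^] k'" using Suc.prems y by (simp add: m_assoc)
    also have "\<dots> = y [^] (l + k') \<otimes> d" using y dc by (simp add: ld m_ac flip: nat_pow_mult)
    finally show ?case using ld by blast
  qed
  then show thesis using that[OF Cs Cx] Cp by blast
qed

text \<open>Take x of prime order p in N and a root y of x of greatest p-height. The cyclic group Y
  generated by y has a complement C, and the endomorphism is the p-th power on Y and the identity on
  C. Its kernel consists of the elements of order dividing p in Y, which are powers of x.\<close>

lemma (in comm_group) endomorphism_with_kernel_inside:
  assumes fin: "finite (carrier G)" and N: "subgroup N G" "N \<noteq> {\<one>}"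
  obtains \<theta> where "\<theta> \<in> hom G G" "kernel G G \<theta> \<subseteq> N" "kernel G G \<theta> \<noteq> {\<one>}"
proof -
  interpret N: subgroup N G by (rule N(1))
  obtain a where a: "a \<in> N" "a \<noteq> \<one>" using N N.one_closed by blast
  have ac: "a \<in> carrier G" using a by auto
  have "ord a \<noteq> 1" using ord_eq_1[OF ac] a by simp
  then obtain p where p: "prime p" "p dvd ord a" using prime_factor_nat by blast
  define x where "x = a [^] (ord a div p)"
  have xN: "x \<in> N" unfolding x_def by (rule subgroup_nat_pow_closed[OF N(1) a(1)])
  then have xc: "x \<in> carrier G" by auto
  have "ord a > 0" using ord_ge_1[OF fin ac] by simp
  have x1: "x \<noteq> \<one>"
  proof
    assume "x = \<one>"
    then have "ord a dvd ord a div p" using pow_eq_id[OF ac] by (simp add: x_def)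
    moreover have "0 < ord a div p" "ord a div p < ord a"
      using \<open>ord a > 0\<close> p prime_gt_1_nat[OF p(1)] by (auto simp: div_greater_zero_iff dvd_imp_le prime_gt_0_nat)
    ultimately show False by (meson dvd_imp_le not_le)
  qed
  have xp: "x [^] p = \<one>" using ac p by (simp add: x_def nat_pow_pow)
  \<comment> \<open>The exact order of a p^h-th root of x bounds the height by the group order, so a
    greatest height exists; it also gives the order of y.\<close>
  have ordz: "ord z = p ^ Suc h" if "z \<in> carrier G" "z [^] (p ^ h) = x" for z h
  proof -
    have "z [^] (p ^ Suc h) = \<one>" using that xp by (simp add: nat_pow_pow mult.commute flip: that(2))
    then have "ord z dvd p ^ Suc h" using pow_eq_id[OF that(1)] by simp
    then obtain i where i: "i \<le> Suc h" "ord z = p ^ i" using divides_primepow_nat[OF p(1)] by blast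
    have "\<not> ord z dvd p ^ h" using pow_eq_id[OF that(1), of "p ^ h"] that x1 by simp
    then have "\<not> i \<le> h" using i le_imp_power_dvd by metis
    then have "i = Suc h" using i by simp
    then show ?thesis using i by simp
  qed
  let ?P = "\<lambda>h. \<exists>z\<in>carrier G. z [^] (p ^ h) = x"
  have bound: "h \<le> order G" if h: "?P h" for h
  proof -
    obtain z where z: "z \<in> carrier G" "z [^] (p ^ h) = x" using h by blast
    have "h < p ^ h" using prime_gt_1_nat[OF p(1)] by (simp add: power_gt_expt)
    also have "p ^ h \<le> p ^ Suc h" using prime_gt_1_nat[OF p(1)] by simp
    also have "\<dots> \<le> order G" using ord_le_group_order[OF fin z(1)] ordz[OF z] by simp
    finally show ?thesis by simp
  qed
  have "?P 0" using xc by (intro bexI[of _ x]) auto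
  then have "?P (Greatest ?P)" by (rule GreatestI_nat) (use bound in blast)
  then obtain y h where h: "h = Greatest ?P" and y: "y \<in> carrier G" "y [^] (p ^ h) = x" by blast
  have max: "z [^] (p ^ Suc h) \<noteq> x" if "z \<in> carrier G" for z
    using Greatest_le_nat[of ?P "Suc h" "order G"] bound that unfolding h[symmetric] by force
  obtain C where C: "subgroup C G" "x \<notin> C"
    and dec: "\<And>g. g \<in> carrier G \<Longrightarrow> \<exists>k::nat. \<exists>c\<in>C. g = y [^] k \<otimes> c"
    using cyclic_complement[OF fin p(1) y(1) y(2)[symmetric] x1 xp max] by metis
  interpret C: subgroup C G by (rule C(1))
  define Y where "Y = {y [^] k | k. k \<in> (UNIV :: nat set)}"
  have Yg: "Y = generate G {y}" unfolding Y_def by (rule generate_pow_on_finite_carrier[OF fin y(1), symmetric])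
  have "subgroup Y G" unfolding Yg by (rule generate_is_subgroup) (use y in simp)
  then interpret Y: subgroup Y G .
  \<comment> \<open>For z = y^k nontrivial, the p-part of k is at most p^h. A suitable p-power of z
    is then x^k' with p not dividing k', which would put x into C.\<close>
  have YC: "z = \<one>" if z: "z \<in> Y" "z \<in> C" for z
  proof (rule ccontr)
    assume z1: "z \<noteq> \<one>"
    obtain k :: nat where k: "z = y [^] k" using z by (auto simp: Y_def)
    have "k \<noteq> 0" using z1 k by (metis nat_pow_0)
    obtain k' where k': "k = p ^ multiplicity p k * k'" "\<not> p dvd k'"
      using multiplicity_decompose'[of k p] \<open>k \<noteq> 0\<close> p(1)
      by (metis not_prime_unit)
    have "\<not> p ^ Suc h dvd k" using z1 pow_eq_id[OF y(1)] ordz[OF y] k by simp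
    then have le: "multiplicity p k \<le> h"
      using multiplicity_dvd' by (metis not_less_eq_eq)
    have "z [^] (p ^ (h - multiplicity p k)) = y [^] (p ^ h * k')"
    proof -
      have "k * p ^ (h - multiplicity p k) = p ^ h * k'"
        using le by (subst k'(1)) (simp flip: power_add)
      then show ?thesis using y by (simp add: k nat_pow_pow)
    qed
    also have "\<dots> = x [^] k'" using y(1) by (simp flip: y(2) add: nat_pow_pow)
    finally have "x [^] k' \<in> C" using subgroup_nat_pow_closed[OF C(1) z(2)] by metis
    then show False using prime_order_pow_mem[OF C(1) xc p(1) xp] k'(2) C(2) by blast
  qed
  have ex1: "\<exists>!z. z \<in> Y \<and> g \<otimes> inv z \<in> C" if g: "g \<in> carrier G" for g
  proof (rule ex_ex1I)
    obtain k :: nat and c where kc: "c \<in> C" "g = y [^] k \<otimes> c" using dec[OF g] by blast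
    have "g \<otimes> inv (y [^] k) = c"
      using kc y C.mem_carrier[OF kc(1)] by (simp add: m_ac)
    then show "\<exists>z. z \<in> Y \<and> g \<otimes> inv z \<in> C" using kc Y_def by blast
  next
    fix z z' assume z: "z \<in> Y \<and> g \<otimes> inv z \<in> C" and z': "z' \<in> Y \<and> g \<otimes> inv z' \<in> C"
    then have zc: "z \<in> carrier G" "z' \<in> carrier G" by auto
    have "inv (g \<otimes> inv z) \<otimes> (g \<otimes> inv z') \<in> C" using z z' by blast
    moreover have "inv (g \<otimes> inv z) \<otimes> (g \<otimes> inv z') = z \<otimes> inv z'"
      using g zc by (simp add: inv_mult_group m_assoc) (simp flip: m_assoc)
    ultimately have "z \<otimes> inv z' = \<one>" using YC z z' by auto
    then show "z = z'" using zc by (metis inv_equality inv_inv inv_closed)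
  qed
  define \<pi> where "\<pi> g = (THE z. z \<in> Y \<and> g \<otimes> inv z \<in> C)" for g
  have pi: "\<pi> g \<in> Y \<and> g \<otimes> inv (\<pi> g) \<in> C" if "g \<in> carrier G" for g
    unfolding \<pi>_def by (rule theI'[OF ex1[OF that]])
  have pi_eq: "\<pi> g = z" if "g \<in> carrier G" "z \<in> Y" "g \<otimes> inv z \<in> C" for g z
    using ex1[OF that(1)] pi[OF that(1)] that by blast
  have piY: "\<pi> g = g" if "g \<in> Y" for g
    using that by (intro pi_eq) auto
  have pic: "\<pi> g \<in> carrier G" if "g \<in> carrier G" for g using pi[OF that] by auto
  have pim: "\<pi> (g \<otimes> g') = \<pi> g \<otimes> \<pi> g'" if g: "g \<in> carrier G" "g' \<in> carrier G" for g g'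
  proof (rule pi_eq)
    have "g \<otimes> inv (\<pi> g) \<otimes> (g' \<otimes> inv (\<pi> g')) \<in> C" using pi g by blast
    also have "g \<otimes> inv (\<pi> g) \<otimes> (g' \<otimes> inv (\<pi> g')) = g \<otimes> g' \<otimes> inv (\<pi> g \<otimes> \<pi> g')"
      using g pic by (simp add: inv_mult_group m_ac)
    finally show "g \<otimes> g' \<otimes> inv (\<pi> g \<otimes> \<pi> g') \<in> C" .
  qed (use g pi in auto)
  \<comment> \<open>The factor \<open>\<pi> g [^] (p - 1)\<close> tops up the Y-component to its
    p-th power and leaves the C-component alone.\<close>
  define \<theta> where "\<theta> g = g \<otimes> \<pi> g [^] (p - 1)" for g
  have "\<theta> \<in> hom G G"
    by (rule homI) (use pic pim in \<open>auto simp: \<theta>_def nat_pow_distrib m_ac\<close>)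
  moreover have thetaY: "\<theta> g = g [^] p" if "g \<in> Y" for g
  proof -
    have "g \<otimes> g [^] (p - 1) = g [^] Suc (p - 1)" using that by (simp add: m_comm)
    then show ?thesis using that prime_gt_0_nat[OF p(1)] by (simp add: \<theta>_def piY)
  qed
  have xY: "x \<in> Y" using y by (auto simp: Y_def)
  have "kernel G G \<theta> \<subseteq> N"
  proof
    fix g assume "g \<in> kernel G G \<theta>"
    then have g: "g \<in> carrier G" "\<theta> g = \<one>" by (auto simp: kernel_def)
    then have "g = inv (\<pi> g [^] (p - 1))"
      using pic by (metis \<theta>_def inv_equality nat_pow_closed)
    then have gY: "g \<in> Y"
      using pi[OF g(1)] subgroup_nat_pow_closed[OF Y.subgroup_axioms] by (metis Y.m_inv_closed)
    then obtain k :: nat where k: "g = y [^] k" by (auto simp: Y_def)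
    have "y [^] (k * p) = \<one>" using thetaY[OF gY] g(2) y(1) by (simp add: k nat_pow_pow)
    then have "p ^ Suc h dvd k * p" using pow_eq_id[OF y(1)] ordz[OF y] by simp
    then have "p ^ h dvd k" using prime_gt_0_nat[OF p(1)] by (simp add: mult.commute)
    then obtain j where "k = p ^ h * j" by auto
    then have "g = x [^] j" using y(1) by (simp add: k nat_pow_pow flip: y(2))
    then show "g \<in> N" using subgroup_nat_pow_closed[OF N(1) xN] by simp
  qed
  moreover have "x \<in> kernel G G \<theta>"
    using xc thetaY[OF xY] xp by (simp add: kernel_def)
  ultimately show thesis using that x1 by blast
qed

text \<open>Dividing by the kernel of the endomorphism above shrinks the group without leaving it, so no
  structure theorem is needed.\<close>

theorem finite_abelian_quotient_embeds:
  fixes G :: "('a, 'm) monoid_scheme"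
  assumes "comm_group G" "finite (carrier G)" "group S" "\<phi> \<in> hom G S" "\<phi> ` carrier G = carrier S"
  shows "\<exists>K. subgroup K G \<and> S \<cong> G\<lparr>carrier := K\<rparr>"
  using assms(1,2,4,5)
proof (induction "card (carrier G)" arbitrary: G \<phi> rule: less_induct)
  case less
  interpret G: comm_group G by (rule less)
  interpret h: group_hom G S \<phi>
    using less.prems(3) assms(3) by (simp add: group_hom_def group_hom_axioms_def G.is_group)
  show ?case
  proof (cases "kernel G S \<phi> = {\<one>\<^bsub>G\<^esub>}")
    case True
    then have "\<phi> \<in> iso G S"
      using h.trivial_ker_imp_inj less.prems by (simp add: iso_def bij_betw_def)
    then have "S \<cong> G" using G.iso_set_sym is_isoI by blast
    then show ?thesis using G.subgroup_self by (intro exI[of _ "carrier G"]) simp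
  next
    case False
    then obtain \<theta> where t: "\<theta> \<in> hom G G" "kernel G G \<theta> \<subseteq> kernel G S \<phi>" "kernel G G \<theta> \<noteq> {\<one>\<^bsub>G\<^esub>}"
      using G.endomorphism_with_kernel_inside[OF less.prems(2) h.subgroup_kernel] by metis
    interpret t: group_hom G G \<theta>
      using t(1) by (simp add: group_hom_def group_hom_axioms_def G.is_group)
    let ?I = "\<theta> ` carrier G"
    let ?G = "G\<lparr>carrier := ?I\<rparr>"
    have I: "subgroup ?I G" by (rule t.img_is_subgroup)
    have "\<not> inj_on \<theta> (carrier G)" using t.inj_iff_trivial_ker t(3) by simp
    then have card: "card (carrier ?G) < card (carrier G)"
      using card_image_le[OF less.prems(2), of \<theta>] eq_card_imp_inj_on[OF less.prems(2), of \<theta>]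
      by force
    have cg: "comm_group ?G" 
      by (rule group.group_comm_groupI[OF subgroup.subgroup_is_group[OF I G.is_group]])
         (auto simp: G.m_comm)
    \<comment> \<open>As the kernel of \<open>\<theta>\<close> lies in that of
      \<open>\<phi>\<close>, the map \<open>\<phi>\<close> factors through the image of
      \<open>\<theta>\<close>, a strictly smaller subgroup that still maps onto S.\<close>
    have wd: "\<phi> a = \<phi> b" if "a \<in> carrier G" "b \<in> carrier G" "\<theta> a = \<theta> b" for a b
    proof -
      have "a \<otimes>\<^bsub>G\<^esub> inv\<^bsub>G\<^esub> b \<in> kernel G G \<theta>" using that by (simp add: kernel_def)
      then have "\<phi> (a \<otimes>\<^bsub>G\<^esub> inv\<^bsub>G\<^esub> b) = \<one>\<^bsub>S\<^esub>" using t(2) by (auto simp: kernel_def)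
      then show ?thesis using that by (metis G.inv_closed h.H.inv_inv h.H.inv_equality h.hom_closed h.hom_inv h.hom_mult)
    qed
    define \<psi> where "\<psi> c = \<phi> (inv_into (carrier G) \<theta> c)" for c
    have psi: "\<psi> (\<theta> a) = \<phi> a" if "a \<in> carrier G" for a
      unfolding \<psi>_def using that by (intro wd) (auto intro: inv_into_into f_inv_into_f)
    have "\<psi> \<in> hom ?G S"
    proof (rule homI)
      fix c d assume "c \<in> carrier ?G" "d \<in> carrier ?G"
      then obtain a b where ab: "a \<in> carrier G" "b \<in> carrier G" "c = \<theta> a" "d = \<theta> b" by auto
      then show "\<psi> (c \<otimes>\<^bsub>?G\<^esub> d) = \<psi> c \<otimes>\<^bsub>S\<^esub> \<psi> d"
        using psi[of "a \<otimes>\<^bsub>G\<^esub> b"] psi by simp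
    qed (use psi in auto)
    moreover have "\<psi> ` carrier ?G = carrier S"
      using psi less.prems(4) by (auto simp: image_image)
    moreover have "finite (carrier ?G)" using less.prems(2) by simp
    ultimately obtain K where K: "subgroup K ?G" "S \<cong> ?G\<lparr>carrier := K\<rparr>"
      using less.hyps[OF card cg] by blast
    then show ?thesis using G.incl_subgroup[OF I] by auto
  qed
qed

section \<open>Free groups\<close>

lemma not_successivelyE:
  assumes "\<not> successively P xs"
  obtains us a b vs where "xs = us @ a # b # vs" "\<not> P a b"
proof -
  have "\<exists>us a b vs. xs = us @ a # b # vs \<and> \<not> P a b"
    using assms
  proof (induction xs rule: induct_list012)
    case (3 x y zs)
    show ?case
    proof (cases "P x y")
      case True
      then obtain us a b vs where "y # zs = us @ a # b # vs" "\<not> P a b" using 3 by auto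
      then show ?thesis by (intro exI[of _ "x # us"] exI) auto
    next
      case False
      then show ?thesis by (intro exI[of _ "[]"] exI) auto
    qed
  qed auto
  then show thesis using that by blast
qed

lemma (in group) signed_prod_closed:
  "fst ` set ws \<subseteq> carrier G \<Longrightarrow> signed_prod G ws \<in> carrier G"
  by (induction ws) (auto simp: signed_prod_def)

lemma (in group) signed_prod_append:
  "fst ` set us \<subseteq> carrier G \<Longrightarrow> fst ` set vs \<subseteq> carrier G \<Longrightarrow>
    signed_prod G (us @ vs) = signed_prod G us \<otimes> signed_prod G vs"
  using signed_prod_closed[of vs]
proof (induction us)
  case (Cons a us)
  then show ?case
    using signed_prod_closed[of us] signed_prod_closed[of vs]
    by (cases a) (auto simp: signed_prod_def m_assoc)
qed (simp add: signed_prod_def)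

lemma (in group) signed_prod_inverse:
  "fst ` set ws \<subseteq> carrier G \<Longrightarrow>
    signed_prod G (rev (map (\<lambda>(x, b). (x, \<not> b)) ws)) = inv (signed_prod G ws)"
proof (induction ws)
  case (Cons a ws)
  obtain x b where a: "a = (x, b)" by force
  have c: "x \<in> carrier G" "fst ` set ws \<subseteq> carrier G" using Cons.prems by (auto simp: a)
  have s: "fst ` set (rev (map (\<lambda>(x, b). (x, \<not> b)) ws)) \<subseteq> carrier G" using c by force
  show ?case
    using Cons.IH[OF c(2)] c s signed_prod_closed[OF c(2)]
    by (simp add: a signed_prod_append) (simp add: signed_prod_def inv_mult_group)
qed (simp add: signed_prod_def)

lemma (in group) generate_signed_prod:
  assumes "X \<subseteq> carrier G" "g \<in> generate G X"
  shows "\<exists>ws. fst ` set ws \<subseteq> X \<and> signed_prod G ws = g"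
  using assms(2)
proof (induction rule: generate.induct)
  case one
  show ?case by (intro exI[of _ "[]"]) (simp add: signed_prod_def)
next
  case (incl h)
  then show ?case using assms by (intro exI[of _ "[(h, True)]"]) (auto simp: signed_prod_def)
next
  case (inv h)
  then show ?case using assms by (intro exI[of _ "[(h, False)]"]) (auto simp: signed_prod_def)
next
  case (eng h1 h2)
  then obtain us vs where "fst ` set us \<subseteq> X" "signed_prod G us = h1"
    "fst ` set vs \<subseteq> X" "signed_prod G vs = h2" by blast
  then show ?case
    using assms(1) signed_prod_append[of us vs] by (intro exI[of _ "us @ vs"]) auto
qed

text \<open>A word whose product is trivial in a free group cancels completely, hence has trivial image.\<close>

theorem free_on_universal:
  assumes free: "free_on F X" and "group G" and f: "f ` X \<subseteq> carrier G"
  obtains \<beta> where "\<beta> \<in> hom F G" "\<And>x. x \<in> X \<Longrightarrow> \<beta> x = f x"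
proof -
  interpret F: group F using free by (simp add: free_on_def)
  interpret G: group G by fact
  have X: "X \<subseteq> carrier F" and gen: "generate F X = carrier F"
    and red: "\<And>ws. ws \<noteq> [] \<Longrightarrow> fst ` set ws \<subseteq> X \<Longrightarrow> reduced_word ws \<Longrightarrow> signed_prod F ws \<noteq> \<one>\<^bsub>F\<^esub>"
    using free by (auto simp: free_on_def)
  define m where "m = map (map_prod f (\<lambda>b::bool. b))"
  have mX: "fst ` set (m ws) \<subseteq> carrier G" if "fst ` set ws \<subseteq> X" for ws
    using that f by (force simp: m_def)
  have triv: "signed_prod G (m ws) = \<one>\<^bsub>G\<^esub>"
    if "fst ` set ws \<subseteq> X" "signed_prod F ws = \<one>\<^bsub>F\<^esub>" for ws
    using that
  proof (induction ws rule: length_induct)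
    case (1 ws)
    show ?case
    proof (cases "ws = []")
      case True
      then show ?thesis by (simp add: m_def signed_prod_def)
    next
      case False
      then have "\<not> reduced_word ws" using red 1 by blast
      then obtain us p q vs where ws: "ws = us @ p # q # vs"
        and pq: "\<not> (case p of (x, b) \<Rightarrow> \<lambda>(y, c). x = y \<longrightarrow> b = c) q"
        unfolding reduced_word_def by (rule not_successivelyE)
      obtain x b where p: "p = (x, b)" by force
      have q: "q = (x, \<not> b)" using pq by (cases q) (auto simp: p)
      have xX: "x \<in> X" "fst ` set us \<subseteq> X" "fst ` set vs \<subseteq> X" using 1 by (auto simp: ws p)
      then have xF: "x \<in> carrier F" "fst ` set us \<subseteq> carrier F" "fst ` set vs \<subseteq> carrier F"
        using X by auto
      have xG: "f x \<in> carrier G" using f xX by auto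
      have "signed_prod F (p # q # vs) = signed_prod F vs"
        using xF F.signed_prod_closed[of vs]
        by (cases b) (simp_all add: p q signed_prod_def flip: F.m_assoc)
      then have "signed_prod F (us @ vs) = \<one>\<^bsub>F\<^esub>"
        using 1 xF F.signed_prod_append[of us "p # q # vs"] F.signed_prod_append[of us vs]
        by (auto simp: ws p q)
      then have IH: "signed_prod G (m (us @ vs)) = \<one>\<^bsub>G\<^esub>"
        using 1 xX by (auto simp: ws)
      have "signed_prod G (m (p # q # vs)) = signed_prod G (m vs)"
        using xG G.signed_prod_closed[OF mX[OF xX(3)]]
        by (cases b) (simp_all add: p q m_def signed_prod_def flip: G.m_assoc)
      moreover have "fst ` set (m (p # q # vs)) \<subseteq> carrier G"
        by (rule mX) (use xX in \<open>auto simp: p q\<close>)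
      ultimately have "signed_prod G (m us @ m (p # q # vs)) = signed_prod G (m us @ m vs)"
        using G.signed_prod_append[OF mX[OF xX(2)]] mX[OF xX(3)] by simp
      then show ?thesis using IH by (simp add: ws m_def)
    qed
  qed
  have wd: "signed_prod G (m us) = signed_prod G (m vs)"
    if us: "fst ` set us \<subseteq> X" and vs: "fst ` set vs \<subseteq> X"
      and eq: "signed_prod F us = signed_prod F vs" for us vs
  proof -
    define vs' where "vs' = rev (map (\<lambda>(x, b). (x, \<not> b)) vs)"
    have vs': "fst ` set vs' \<subseteq> X" using vs by (force simp: vs'_def)
    have c: "fst ` set us \<subseteq> carrier F" "fst ` set vs \<subseteq> carrier F" "fst ` set vs' \<subseteq> carrier F"
      using us vs vs' X by auto
    have "signed_prod F (us @ vs') = \<one>\<^bsub>F\<^esub>"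
      using F.signed_prod_append[OF c(1,3)] F.signed_prod_inverse[OF c(2)] eq
        F.signed_prod_closed[OF c(2)] by (simp add: vs'_def)
    then have "signed_prod G (m (us @ vs')) = \<one>\<^bsub>G\<^esub>" using triv us vs' by (simp add: image_Un)
    moreover have "m vs' = rev (map (\<lambda>(x, b). (x, \<not> b)) (m vs))"
      by (auto simp: m_def vs'_def rev_map)
    ultimately have "signed_prod G (m us) \<otimes>\<^bsub>G\<^esub> inv\<^bsub>G\<^esub> signed_prod G (m vs) = \<one>\<^bsub>G\<^esub>"
      using G.signed_prod_append[OF mX[OF us] mX[OF vs']] G.signed_prod_inverse[OF mX[OF vs]]
      by (simp add: m_def)
    then show ?thesis
      using G.signed_prod_closed[OF mX[OF us]] G.signed_prod_closed[OF mX[OF vs]]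
      by (metis G.inv_equality G.inv_inv G.inv_closed)
  qed
  \<comment> \<open>Any spelling of g may be chosen: by the fact just shown, words with equal
    product in F have images with equal product in G.\<close>
  define wd where "wd g = (SOME ws. fst ` set ws \<subseteq> X \<and> signed_prod F ws = g)" for g
  have w: "fst ` set (wd g) \<subseteq> X \<and> signed_prod F (wd g) = g" if "g \<in> carrier F" for g
    unfolding wd_def by (rule someI_ex) (use F.generate_signed_prod[OF X] gen that in simp)
  define \<beta> where "\<beta> g = signed_prod G (m (wd g))" for g
  have "\<beta> \<in> hom F G"
  proof (rule homI)
    fix g h assume gh: "g \<in> carrier F" "h \<in> carrier F"
    have c: "fst ` set (wd g) \<subseteq> carrier F" "fst ` set (wd h) \<subseteq> carrier F"
      using w gh X by blast+
    have "\<beta> (g \<otimes>\<^bsub>F\<^esub> h) = signed_prod G (m (wd g @ wd h))"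
      unfolding \<beta>_def
      by (rule wd) (use w gh F.signed_prod_append[OF c] in \<open>auto simp: image_Un\<close>)
    also have "\<dots> = \<beta> g \<otimes>\<^bsub>G\<^esub> \<beta> h"
      using G.signed_prod_append mX w gh by (simp add: \<beta>_def m_def)
    finally show "\<beta> (g \<otimes>\<^bsub>F\<^esub> h) = \<beta> g \<otimes>\<^bsub>G\<^esub> \<beta> h" .
  qed (use G.signed_prod_closed mX w in \<open>auto simp: \<beta>_def\<close>)
  moreover have "\<beta> x = f x" if x: "x \<in> X" for x
  proof -
    have "\<beta> x = signed_prod G (m [(x, True)])"
      unfolding \<beta>_def
      by (rule wd) (use w[of x] x X in \<open>auto simp: signed_prod_def\<close>)
    then show ?thesis using f x by (auto simp: m_def signed_prod_def)
  qed
  ultimately show thesis using that by blast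
qed

section \<open>Transfer and commutators with verbal subgroups\<close>

text \<open>For normal C this is the preimage in G of the centralizer, inside G/C, of the image of
  S.\<close>

definition centralizer_mod :: "('a, 'm) monoid_scheme \<Rightarrow> 'a set \<Rightarrow> 'a set \<Rightarrow> 'a set" where
  "centralizer_mod G C S = {g \<in> carrier G. \<forall>s\<in>S. commutator G g s \<in> C}"

lemma (in group) commutator_mem_sym:
  assumes "C \<lhd> G" "x \<in> carrier G" "y \<in> carrier G"
  shows "commutator G x y \<in> C \<longleftrightarrow> commutator G y x \<in> C"
  using normal.commutator_mem_iff[OF assms(1)] assms by metis

lemma (in group) normal_centralizer_mod:
  assumes C: "C \<lhd> G" and S: "S \<subseteq> carrier G"
    and conj: "\<And>g s. g \<in> carrier G \<Longrightarrow> s \<in> S \<Longrightarrow> g \<otimes> s \<otimes> inv g \<in> S"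
  shows "centralizer_mod G C S \<lhd> G"
proof -
  let ?Z = "centralizer_mod G C S"
  interpret C: normal C G by (rule C)
  have sub: "?Z \<subseteq> carrier G" by (auto simp: centralizer_mod_def)
  \<comment> \<open>Closure under the group operations is read off from
    \<open>commutator_generate\<close>: the set contains everything it generates.\<close>
  have "generate G ?Z \<subseteq> ?Z"
  proof
    fix g assume g: "g \<in> generate G ?Z"
    then have "commutator G g s \<in> C" if "s \<in> S" for s
      using commutator_generate[OF C sub S _ g, of s] generate.incl[OF that]
      by (auto simp: centralizer_mod_def)
    then show "g \<in> ?Z" using g generate_in_carrier[OF sub] by (auto simp: centralizer_mod_def)
  qed
  then have e: "generate G ?Z = ?Z" by (auto intro: generate.incl)
  show ?thesis
    unfolding normal_inv_iff
  proof (intro conjI ballI)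
    show "subgroup ?Z G" using generate_is_subgroup[OF sub] e by simp
  next
    fix x h assume x: "x \<in> carrier G" and h: "h \<in> ?Z"
    have hc: "h \<in> carrier G" using h sub by auto
    have "commutator G (x \<otimes> h \<otimes> inv x) s \<in> C" if s: "s \<in> S" for s
    proof -
      have sc: "s \<in> carrier G" using s S by auto
      have "inv x \<otimes> s \<otimes> x \<in> S" using conj[of "inv x" s] s x by simp
      then have "commutator G h (inv x \<otimes> s \<otimes> x) \<in> C" using h by (auto simp: centralizer_mod_def)
      then have "x \<otimes> commutator G h (inv x \<otimes> s \<otimes> x) \<otimes> inv x \<in> C" using C.inv_op_closed2 x by blast
      also have "x \<otimes> commutator G h (inv x \<otimes> s \<otimes> x) \<otimes> inv x = commutator G (x \<otimes> h \<otimes> inv x) s"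
      proof -
        have k: "inv x \<otimes> (x \<otimes> a) = a" "x \<otimes> (inv x \<otimes> a) = a" if "a \<in> carrier G" for a
          using x that by (simp_all flip: m_assoc)
        show ?thesis using x hc sc by (simp add: commutator_def inv_mult_group m_assoc k)
      qed
      finally show ?thesis .
    qed
    then show "x \<otimes> h \<otimes> inv x \<in> ?Z" using x hc by (simp add: centralizer_mod_def)
  qed
qed

section \<open>Commutator calculus with central commutators\<close>

lemma (in group) normal_one: "{\<one>} \<lhd> G"
  unfolding normal_inv_iff by (auto simp: triv_subgroup)

lemma (in group) commutator_mem_normal:
  assumes L: "L \<lhd> G" and "x \<in> carrier G" "l \<in> L"
  shows "commutator G x l \<in> L" "commutator G l x \<in> L"
proof -
  interpret L: normal L G by (rule L)
  have "inv x \<otimes> inv l \<otimes> x \<in> L" "inv x \<otimes> l \<otimes> x \<in> L"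
    using L.inv_op_closed1 assms(2,3) by auto
  then have "inv x \<otimes> inv l \<otimes> x \<otimes> l \<in> L" "inv l \<otimes> (inv x \<otimes> l \<otimes> x) \<in> L"
    using assms(3) by auto
  then show "commutator G x l \<in> L" "commutator G l x \<in> L"
    using assms L.mem_carrier[OF assms(3)] by (auto simp: commutator_def m_assoc)
qed

lemma (in group) verbal_commutator_nested:
  assumes fresh: "a \<notin> word_vars w" "b \<notin> word_vars w" "a \<noteq> b"
    and "u \<in> word_values {w} G" "x \<in> carrier G" "y \<in> carrier G"
  shows "commutator G (commutator G u x) y \<in> word_values {Comm (Comm w (Var a)) (Var b)} G"
proof -
  have 1: "word_vars (Comm w (Var a)) \<inter> word_vars (Var b) = {}"
    and 2: "word_vars w \<inter> word_vars (Var a) = {}" using fresh by auto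
  show ?thesis
    unfolding word_values_comm[OF 1] word_values_comm[OF 2] word_values_Var
    using assms by blast
qed

text \<open>Conjugation by u changes x and y only by central factors, and central factors do not
  affect the commutator of x and y. The calculation evaluates u x y in two ways and cancels.\<close>

lemma (in group) commutes_commutator:
  assumes u: "u \<in> carrier G" and x: "x \<in> carrier G" and y: "y \<in> carrier G"
    and xc: "\<And>g. g \<in> carrier G \<Longrightarrow> commutator G u x \<otimes> g = g \<otimes> commutator G u x"
    and yc: "\<And>g. g \<in> carrier G \<Longrightarrow> commutator G u y \<otimes> g = g \<otimes> commutator G u y"
  shows "u \<otimes> commutator G x y = commutator G x y \<otimes> u"
proof -
  let ?p = "commutator G u x" and ?q = "commutator G u y"
  have k: "inv z \<otimes> (z \<otimes> a) = a" "z \<otimes> (inv z \<otimes> a) = a"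
    if "z \<in> carrier G" "a \<in> carrier G" for z a
    using that by (simp_all flip: m_assoc)
  have ux: "u \<otimes> x = x \<otimes> u \<otimes> ?p" and uy: "u \<otimes> y = y \<otimes> u \<otimes> ?q"
    using u x y by (simp_all add: commutator_def m_assoc k)
  have "u \<otimes> (x \<otimes> y) = u \<otimes> (y \<otimes> x \<otimes> commutator G x y)"
    using x y by (simp add: commutator_def m_assoc k)
  moreover have "u \<otimes> (x \<otimes> y) = (x \<otimes> y) \<otimes> u \<otimes> (?p \<otimes> ?q)"
  proof -
    have "u \<otimes> (x \<otimes> y) = x \<otimes> u \<otimes> (?p \<otimes> y)" using ux u x y by (simp flip: m_assoc)
    also have "\<dots> = x \<otimes> (u \<otimes> y) \<otimes> ?p" using xc[OF y] u x y by (simp add: m_assoc)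
    also have "\<dots> = (x \<otimes> y) \<otimes> u \<otimes> (?q \<otimes> ?p)" using uy u x y by (simp add: m_assoc)
    also have "?q \<otimes> ?p = ?p \<otimes> ?q" using yc[of ?p] u x by simp
    finally show ?thesis .
  qed
  moreover have "u \<otimes> (y \<otimes> x \<otimes> commutator G x y) = (y \<otimes> x) \<otimes> (u \<otimes> commutator G x y) \<otimes> (?p \<otimes> ?q)"
  proof -
    let ?c = "commutator G x y"
    have cc: "?c \<in> carrier G" "?p \<in> carrier G" "?q \<in> carrier G" using u x y by auto
    have "u \<otimes> (y \<otimes> x \<otimes> ?c) = (u \<otimes> y) \<otimes> x \<otimes> ?c" using u x y cc by (simp add: m_assoc)
    also have "\<dots> = y \<otimes> u \<otimes> (?q \<otimes> (x \<otimes> ?c))" using u x y cc by (simp add: uy m_assoc)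
    also have "\<dots> = y \<otimes> (u \<otimes> x) \<otimes> ?c \<otimes> ?q"
      using yc[of "x \<otimes> ?c"] u x y cc by (simp add: m_assoc)
    also have "\<dots> = y \<otimes> x \<otimes> u \<otimes> (?p \<otimes> ?c) \<otimes> ?q" using u x y cc by (simp add: ux m_assoc)
    also have "\<dots> = (y \<otimes> x) \<otimes> (u \<otimes> ?c) \<otimes> (?p \<otimes> ?q)"
      using xc[of ?c] u x y cc by (simp add: m_assoc)
    finally show ?thesis .
  qed
  moreover have "x \<otimes> y = (y \<otimes> x) \<otimes> commutator G x y"
    using x y by (simp add: commutator_def m_assoc k)
  ultimately have e: "(y \<otimes> x) \<otimes> (commutator G x y \<otimes> u) \<otimes> (?p \<otimes> ?q)
      = (y \<otimes> x) \<otimes> (u \<otimes> commutator G x y) \<otimes> (?p \<otimes> ?q)"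
    using u x y by (simp add: m_assoc)
  have "(y \<otimes> x) \<otimes> (commutator G x y \<otimes> u) = (y \<otimes> x) \<otimes> (u \<otimes> commutator G x y)"
    by (rule right_cancel[THEN iffD1, OF _ _ _ e]) (use u x y in auto)
  then show ?thesis using u x y by simp
qed

text \<open>Both l and its conjugate by t have the same central commutator with u, so their quotient
  commutes with u. For the conjugate this holds because conjugating u by t multiplies it by
  \<open>commutator G u t\<close>, which commutes with l.\<close>

lemma (in group) commutes_conj_quotient:
  assumes u: "u \<in> carrier G" and t: "t \<in> carrier G" and l: "l \<in> carrier G"
    and zc: "\<And>g. g \<in> carrier G \<Longrightarrow> commutator G u l \<otimes> g = g \<otimes> commutator G u l"
    and d: "commutator G u t \<otimes> l = l \<otimes> commutator G u t"
  shows "u \<otimes> (inv l \<otimes> (t \<otimes> l \<otimes> inv t)) = (inv l \<otimes> (t \<otimes> l \<otimes> inv t)) \<otimes> u"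
proof -
  let ?z = "commutator G u l" and ?d = "commutator G u t"
  have k: "inv z \<otimes> (z \<otimes> a) = a" "z \<otimes> (inv z \<otimes> a) = a"
    if "z \<in> carrier G" "a \<in> carrier G" for z a
    using that by (simp_all flip: m_assoc)
  have zd: "?z \<in> carrier G" "?d \<in> carrier G" using u l t by auto
  have ul: "u \<otimes> l = l \<otimes> u \<otimes> ?z" and ut: "u \<otimes> t = t \<otimes> (u \<otimes> ?d)"
    and ud: "u \<otimes> ?d = inv t \<otimes> (u \<otimes> t)"
    using u l t by (simp_all add: commutator_def m_assoc k)
  have m: "u \<otimes> (t \<otimes> l \<otimes> inv t) = (t \<otimes> l \<otimes> inv t) \<otimes> u \<otimes> ?z"
  proof -
    have "u \<otimes> (t \<otimes> l \<otimes> inv t) = (u \<otimes> t) \<otimes> l \<otimes> inv t" using u l t by (simp add: m_assoc)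
    also have "\<dots> = t \<otimes> u \<otimes> (?d \<otimes> l) \<otimes> inv t" using u l t zd by (simp add: ut m_assoc)
    also have "\<dots> = t \<otimes> (u \<otimes> l) \<otimes> ?d \<otimes> inv t" using d u l t zd by (simp add: m_assoc)
    also have "\<dots> = t \<otimes> l \<otimes> u \<otimes> (?z \<otimes> (?d \<otimes> inv t))" using u l t zd by (simp add: ul m_assoc)
    also have "\<dots> = t \<otimes> l \<otimes> (u \<otimes> ?d) \<otimes> inv t \<otimes> ?z"
      using zc[of "?d \<otimes> inv t"] u l t zd by (simp add: m_assoc)
    also have "\<dots> = (t \<otimes> l \<otimes> inv t) \<otimes> u \<otimes> ?z" using u l t zd by (simp add: ud m_assoc)
    finally show ?thesis .
  qed
  let ?m = "t \<otimes> l \<otimes> inv t"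
  have mc: "?m \<in> carrier G" using t l by auto
  have "l \<otimes> (u \<otimes> (inv l \<otimes> ?m)) \<otimes> ?z = (l \<otimes> u \<otimes> ?z) \<otimes> (inv l \<otimes> ?m)"
    using zc[of "inv l \<otimes> ?m"] u l mc zd by (simp add: m_assoc)
  also have "\<dots> = u \<otimes> ?m" using u l mc by (simp add: k m_assoc flip: ul)
  also have "\<dots> = l \<otimes> (inv l \<otimes> ?m \<otimes> u) \<otimes> ?z" using u l mc zd by (simp add: m k m_assoc)
  finally have e: "l \<otimes> (u \<otimes> (inv l \<otimes> ?m)) \<otimes> ?z = l \<otimes> (inv l \<otimes> ?m \<otimes> u) \<otimes> ?z" .
  have "l \<otimes> (u \<otimes> (inv l \<otimes> ?m)) = l \<otimes> (inv l \<otimes> ?m \<otimes> u)"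
    by (rule right_cancel[THEN iffD1, OF _ _ _ e]) (use u l mc zd in auto)
  then show ?thesis using u l mc by simp
qed

section \<open>Comparing words in a subgroup and in the whole group\<close>

lemma finite_set_mult: "finite A \<Longrightarrow> finite B \<Longrightarrow> finite (A <#>\<^bsub>G\<^esub> B)"
  by (simp add: set_mult_def)

lemma (in group) commutator_subgroup_consistent:
  assumes "subgroup B G" "x \<in> B" "y \<in> B"
  shows "commutator (G\<lparr>carrier := B\<rparr>) x y = commutator G x y"
  using assms by (simp add: commutator_def m_inv_consistent)

lemma (in group) word_values_subgroup:
  assumes "subgroup B G"
  shows "word_values {v} (G\<lparr>carrier := B\<rparr>) \<subseteq> word_values {v} G"
proof
  fix x assume "x \<in> word_values {v} (G\<lparr>carrier := B\<rparr>)"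
  then obtain e where e: "x = word_eval (G\<lparr>carrier := B\<rparr>) e v" "\<forall>i. e i \<in> B"
    by (auto simp: word_values_single)
  then have "x = word_eval G e v" using word_eval_subgroup[OF assms] by simp
  then show "x \<in> word_values {v} G"
    using e(2) subgroup.mem_carrier[OF assms] unfolding word_values_single by blast
qed

lemma (in group) verbal_subgroup_mono:
  assumes "subgroup B G"
  shows "verbal_subgroup {v} (G\<lparr>carrier := B\<rparr>) \<subseteq> verbal_subgroup {v} G"
proof -
  interpret B: group "G\<lparr>carrier := B\<rparr>" by (rule subgroup.subgroup_is_group[OF assms is_group])
  have "generate (G\<lparr>carrier := B\<rparr>) (word_values {v} (G\<lparr>carrier := B\<rparr>))
      = generate G (word_values {v} (G\<lparr>carrier := B\<rparr>))"
    by (rule generate_consistent[OF _ assms]) (use B.word_values_carrier in simp)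
  then show ?thesis
    unfolding verbal_subgroup_def using mono_generate[OF word_values_subgroup[OF assms]] by simp
qed

text \<open>X, S and C are kept general because three cases occur: X the group and S = L, or X = L
  and S the group, both with C trivial; and X = S = B with C = V(B). In each, values of v of the
  relevant form fall into C.\<close>

lemma (in group) commutator_verbal_mem_centralizer_mod:
  assumes fresh: "a \<notin> word_vars w" "b \<notin> word_vars w" "a \<noteq> b"
    and v: "v = Comm (Comm w (Var a)) (Var b)" and C: "C \<lhd> G"
    and S: "S \<subseteq> carrier G" "\<And>g s. g \<in> carrier G \<Longrightarrow> s \<in> S \<Longrightarrow> g \<otimes> s \<otimes> inv g \<in> S"
    and X: "X \<subseteq> carrier G"
    and CX: "\<And>u x s. u \<in> word_values {w} G \<Longrightarrow> x \<in> X \<Longrightarrow> s \<in> S \<Longrightarrow>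
      commutator G (commutator G u x) s \<in> word_values {v} G \<Longrightarrow>
      commutator G (commutator G u x) s \<in> C"
    and u: "u \<in> verbal_subgroup {w} G" and x: "x \<in> X"
  shows "commutator G u x \<in> centralizer_mod G C S"
proof (rule commutator_generate[OF normal_centralizer_mod[OF C S] word_values_carrier X])
  show "commutator G u x \<in> centralizer_mod G C S"
    if ux: "u \<in> word_values {w} G" "x \<in> X" for u x
  proof -
    have c: "u \<in> carrier G" "x \<in> carrier G" using ux X word_values_carrier by auto
    then show ?thesis
      using CX[OF ux] verbal_commutator_nested[OF fresh ux(1) c(2)] S(1)
      by (auto simp: centralizer_mod_def v)
  qed
  show "u \<in> generate G (word_values {w} G)" using u by (simp add: verbal_subgroup_def)
  show "x \<in> generate G X" using x by (rule generate.incl)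
qed

text \<open>The transfer into \<open>B\<close> followed by the quotient by the centralizer of \<open>W(B)\<close> modulo \<open>V(B)\<close> maps
  \<open>l\<close> to the class of \<open>l\<close> to the power \<open>[G : B]\<close>, because conjugation does not change the action of
  \<open>l\<close> on \<open>W(G)\<close>; on the other hand it kills commutators.\<close>

theorem (in group) commutator_verbal_pow_index:
  assumes fresh: "a \<notin> word_vars w" "b \<notin> word_vars w" "a \<noteq> b"
    and v: "v = Comm (Comm w (Var a)) (Var b)"
    and L: "L \<lhd> G" "L \<subseteq> verbal_subgroup {v} G" "word_values {v} G \<inter> L \<subseteq> {\<one>}"
    and B: "subgroup B G" "L \<subseteq> B" "finite (rcosets B)"
    and u: "u \<in> verbal_subgroup {w} (G\<lparr>carrier := B\<rparr>)" and l: "l \<in> L"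
  shows "commutator G u (l [^] card (rcosets B)) \<in> verbal_subgroup {v} (G\<lparr>carrier := B\<rparr>)"
proof -
  let ?B = "G\<lparr>carrier := B\<rparr>"
  let ?W = "verbal_subgroup {w} ?B" and ?V = "verbal_subgroup {v} ?B"
  interpret L: normal L G by (rule L)
  interpret B: group ?B by (rule subgroup.subgroup_is_group[OF B(1) is_group])
  interpret VB: normal ?V ?B by (rule B.verbal_subgroup_normal)
  interpret WB: normal ?W ?B by (rule B.verbal_subgroup_normal)
  interpret Q: group_hom ?B "?B Mod ?V" "\<lambda>a. ?V #>\<^bsub>?B\<^esub> a" by (rule VB.coset_hom)
  have Bc: "B \<subseteq> carrier G" by (rule subgroup.subset[OF B(1)])
  have Wc: "?W \<subseteq> B" and Vc: "?V \<subseteq> B" using WB.subset VB.subset by auto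
  note cons = commutator_subgroup_consistent[OF B(1)]
  have uB: "u \<in> B" using u Wc by auto
  have lB: "l \<in> B" using l B(2) by auto
  \<comment> \<open>The double commutator is a value of v, and it lies in L because its last entry
    does; the only such value is \<one>. In \<open>uZ\<close> the inner commutator already lies in
    L.\<close>
  have uL: "commutator G x t \<otimes> m = m \<otimes> commutator G x t"
    if x: "x \<in> verbal_subgroup {w} G" and t: "t \<in> carrier G" and m: "m \<in> L" for x t m
  proof -
    have "commutator G x t \<in> centralizer_mod G {\<one>} L"
    proof (rule commutator_verbal_mem_centralizer_mod[OF fresh v normal_one L.subset _ subset_refl _ x t])
      show "g \<otimes> s \<otimes> inv g \<in> L" if "g \<in> carrier G" "s \<in> L" for g s
        using L.inv_op_closed2 that by simp
      show "commutator G (commutator G u x) s \<in> {\<one>}"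
        if "u \<in> word_values {w} G" "x \<in> carrier G" "s \<in> L"
          "commutator G (commutator G u x) s \<in> word_values {v} G" for u x s
        using that L(3) commutator_mem_normal(1)[OF L(1), of "commutator G u x" s] word_values_carrier
        by blast
    qed
    then show ?thesis
      using m commutator_eq_one_iff by (auto simp: centralizer_mod_def)
  qed
  have uZ: "commutator G x m \<otimes> g = g \<otimes> commutator G x m"
    if x: "x \<in> verbal_subgroup {w} G" and m: "m \<in> L" and g: "g \<in> carrier G" for x m g
  proof -
    have "commutator G x m \<in> centralizer_mod G {\<one>} (carrier G)"
    proof (rule commutator_verbal_mem_centralizer_mod[OF fresh v normal_one subset_refl _ L.subset _ x m])
      show "g \<otimes> s \<otimes> inv g \<in> carrier G" if "g \<in> carrier G" "s \<in> carrier G" for g s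
        using that by simp
      show "commutator G (commutator G u x) s \<in> {\<one>}"
        if "u \<in> word_values {w} G" "x \<in> L" "s \<in> carrier G"
          "commutator G (commutator G u x) s \<in> word_values {v} G" for u x s
      proof -
        have "commutator G u x \<in> L"
          using commutator_mem_normal(1)[OF L(1)] that word_values_carrier by blast
        then show ?thesis
          using that L(3) commutator_mem_normal(2)[OF L(1)] by blast
      qed
    qed
    then show ?thesis
      using g commutator_eq_one_iff by (auto simp: centralizer_mod_def)
  qed
  \<comment> \<open>Inside B all values of v lie in V(B) by definition, so [W(B), B] is central
    modulo V(B).\<close>
  have uC: "commutator ?B x y \<in> centralizer_mod ?B ?V B" if x: "x \<in> ?W" and y: "y \<in> B" for x y
  proof -
    have "commutator ?B x y \<in> centralizer_mod ?B ?V (carrier ?B)"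
    proof (rule B.commutator_verbal_mem_centralizer_mod[OF fresh v VB.normal_axioms subset_refl _ subset_refl _ x])
      show "g \<otimes>\<^bsub>?B\<^esub> s \<otimes>\<^bsub>?B\<^esub> inv\<^bsub>?B\<^esub> g \<in> carrier ?B" if "g \<in> carrier ?B" "s \<in> carrier ?B" for g s
        using that B.m_closed B.inv_closed by blast
      show "z \<in> ?V" if "z \<in> word_values {v} ?B" for z
        using that unfolding verbal_subgroup_def by (rule generate.incl)
    qed (use y in simp)
    then show ?thesis by simp
  qed
  define Y where "Y = centralizer_mod ?B ?V ?W"
  have Y: "Y \<lhd> ?B"
    unfolding Y_def
  proof (rule B.normal_centralizer_mod[OF VB.normal_axioms WB.subset])
    show "g \<otimes>\<^bsub>?B\<^esub> s \<otimes>\<^bsub>?B\<^esub> inv\<^bsub>?B\<^esub> g \<in> ?W" if "g \<in> carrier ?B" "s \<in> ?W" for g s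
      using WB.inv_op_closed2 that by blast
  qed
  interpret Y: normal Y ?B by (rule Y)
  have central: "(?V #>\<^bsub>?B\<^esub> commutator ?B x y) \<otimes>\<^bsub>?B Mod ?V\<^esub> g
      = g \<otimes>\<^bsub>?B Mod ?V\<^esub> (?V #>\<^bsub>?B\<^esub> commutator ?B x y)"
    if x: "x \<in> ?W" and y: "y \<in> B" and g: "g \<in> carrier (?B Mod ?V)" for x y g
  proof -
    obtain g0 where g0: "g0 \<in> carrier ?B" "g = ?V #>\<^bsub>?B\<^esub> g0" using g by (auto simp: carrier_FactGroup)
    have c: "commutator ?B x y \<in> carrier ?B" "commutator ?B (commutator ?B x y) g0 \<in> ?V"
      using uC[OF x y] g0(1) by (auto simp: centralizer_mod_def)
    then show ?thesis
      using VB.commutator_mem_iff[OF c(1) g0(1)] Q.hom_mult[OF c(1) g0(1)] Q.hom_mult[OF g0(1) c(1)]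
      by (simp only: g0(2))
  qed
  \<comment> \<open>By \<open>commutes_commutator\<close> modulo V(B), commutators of B centralize
    W(B). This makes the quotient by Y abelian, hence a legitimate target for the transfer.\<close>
  have YY: "commutator ?B x y \<in> Y" if x: "x \<in> B" and y: "y \<in> B" for x y
  proof -
    have xy: "x \<in> carrier ?B" "y \<in> carrier ?B" "commutator ?B x y \<in> carrier ?B"
      using x y B.commutator_closed[of x y] by auto
    have "commutator ?B (commutator ?B x y) z \<in> ?V" if z: "z \<in> ?W" for z
    proof -
      have zB: "z \<in> carrier ?B" using z Wc by auto
      let ?p = "\<lambda>a. ?V #>\<^bsub>?B\<^esub> a"
      have "?p z \<otimes>\<^bsub>?B Mod ?V\<^esub> commutator (?B Mod ?V) (?p x) (?p y)
          = commutator (?B Mod ?V) (?p x) (?p y) \<otimes>\<^bsub>?B Mod ?V\<^esub> ?p z"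
        by (rule Q.H.commutes_commutator[OF Q.hom_closed[OF zB] Q.hom_closed[OF xy(1)] Q.hom_closed[OF xy(2)]])
           (use central[OF z x] central[OF z y] Q.hom_commutator[OF zB xy(1)] Q.hom_commutator[OF zB xy(2)]
             in \<open>simp_all only:\<close>)
      then have "?p (z \<otimes>\<^bsub>?B\<^esub> commutator ?B x y) = ?p (commutator ?B x y \<otimes>\<^bsub>?B\<^esub> z)"
        using Q.hom_mult[OF zB xy(3)] Q.hom_mult[OF xy(3) zB] Q.hom_commutator[OF xy(1,2)] by (simp only:)
      then show ?thesis using VB.commutator_mem_iff[OF xy(3) zB] by (simp only:)
    qed
    then show ?thesis using xy by (auto simp: Y_def centralizer_mod_def)
  qed
  let ?A = "?B Mod Y" and ?f = "\<lambda>a. Y #>\<^bsub>?B\<^esub> a"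
  interpret A: group_hom ?B ?A ?f by (rule Y.coset_hom)
  have A: "comm_group ?A"
  proof (rule A.H.group_comm_groupI)
    fix x y assume "x \<in> carrier ?A" "y \<in> carrier ?A"
    then obtain x0 y0 where x0: "x0 \<in> carrier ?B" "x = ?f x0" and y0: "y0 \<in> carrier ?B" "y = ?f y0"
      by (auto simp: carrier_FactGroup)
    then have "?f (x0 \<otimes>\<^bsub>?B\<^esub> y0) = ?f (y0 \<otimes>\<^bsub>?B\<^esub> x0)"
      using Y.commutator_mem_iff[OF x0(1) y0(1)] YY[of x0 y0] by simp
    then show "x \<otimes>\<^bsub>?A\<^esub> y = y \<otimes>\<^bsub>?A\<^esub> x"
      using A.hom_mult[OF x0(1) y0(1)] A.hom_mult[OF y0(1) x0(1)] by (simp only: x0(2) y0(2))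
  qed
  interpret A': comm_group ?A by (rule A)
  obtain \<tau> where tau: "\<tau> \<in> hom G ?A"
    and tau_eq: "\<And>h. h \<in> carrier G \<Longrightarrow> (\<And>x. x \<in> carrier G \<Longrightarrow> x \<otimes> h \<otimes> inv x \<in> B) \<Longrightarrow>
       (\<And>x. x \<in> carrier G \<Longrightarrow> ?f (x \<otimes> h \<otimes> inv x) = ?f h) \<Longrightarrow> \<tau> h = ?f h [^]\<^bsub>?A\<^esub> card (rcosets B)"
    using transfer[OF B(1,3) A A.homh] by metis
  interpret T: group_hom G ?A \<tau>
    using tau by (simp add: group_hom_def group_hom_axioms_def is_group A.H.is_group)
  \<comment> \<open>The word v is itself a commutator, so its values die in every abelian
    image.\<close>
  have "verbal_subgroup {v} G \<subseteq> kernel G ?A \<tau>"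
    unfolding verbal_subgroup_def
  proof (rule generate_subgroup_incl[OF _ T.subgroup_kernel])
    show "word_values {v} G \<subseteq> kernel G ?A \<tau>"
    proof
      fix x assume "x \<in> word_values {v} G"
      then obtain e where e: "x = word_eval G e v" "\<And>i. e i \<in> carrier G"
        by (auto simp: word_values_single)
      define c where "c = word_eval G e (Comm w (Var a))"
      have c: "c \<in> carrier G" using word_eval_closed[of e, OF e(2)] by (simp only: c_def)
      have x: "x = commutator G c (e b)" by (simp add: e v c_def)
      have "commutator ?A (\<tau> c) (\<tau> (e b)) = \<one>\<^bsub>?A\<^esub>"
        using A.H.commutator_eq_one_iff[of "\<tau> c" "\<tau> (e b)"] A'.m_comm[of "\<tau> c" "\<tau> (e b)"] c e(2) T.hom_closed
        by blast
      then have "\<tau> x = \<one>\<^bsub>?A\<^esub>" using T.hom_commutator[OF c e(2)[of b]] by (simp only: x)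
      moreover have "x \<in> carrier G" using c e(2) by (simp add: x)
      ultimately show "x \<in> kernel G ?A \<tau>" unfolding kernel_def by blast
    qed
  qed
  then have "\<tau> l = \<one>\<^bsub>?A\<^esub>" using l L(2) by (auto simp: kernel_def)
  moreover have "\<tau> l = ?f l [^]\<^bsub>?A\<^esub> card (rcosets B)"
  proof (rule tau_eq)
    show "l \<in> carrier G" using l by auto
  next
    fix x assume x: "x \<in> carrier G"
    let ?m = "x \<otimes> l \<otimes> inv x"
    have m: "?m \<in> L" using L.inv_op_closed2[OF x l] .
    then show mB: "?m \<in> B" using B(2) by auto
    \<comment> \<open>The conjugate is l times \<open>?q\<close>, and \<open>?q\<close> commutes
      with W(B) exactly, not only modulo V(B); so both have the same class modulo Y.\<close>
    let ?q = "inv\<^bsub>?B\<^esub> l \<otimes>\<^bsub>?B\<^esub> ?m"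
    have qB: "?q \<in> carrier ?B" using lB mB by (intro B.m_closed B.inv_closed) auto
    have q: "?q = inv l \<otimes> ?m" using m_inv_consistent[OF B(1) lB] by simp
    have "commutator ?B ?q z \<in> ?V" if z: "z \<in> ?W" for z
    proof -
      have zG: "z \<in> verbal_subgroup {w} G" using z verbal_subgroup_mono[OF B(1)] by blast
      have zB: "z \<in> carrier ?B" using z Wc by auto
      have lc: "l \<in> carrier G" "z \<in> carrier G" using lB zB Bc by auto
      have "z \<otimes> ?q = ?q \<otimes> z"
        unfolding q
        by (rule commutes_conj_quotient[OF lc(2) x lc(1) uZ[OF zG l] uL[OF zG x l]])
      then have "commutator ?B ?q z = \<one>\<^bsub>?B\<^esub>"
        using B.commutator_eq_one_iff[OF qB zB] by simp
      then show ?thesis using VB.one_closed by simp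
    qed
    then have "?q \<in> Y" using qB by (simp add: Y_def centralizer_mod_def)
    then have "?f ?q = Y" using Y.mem_iff_coset[OF qB] by simp
    moreover have "?f ?m = ?f l \<otimes>\<^bsub>?A\<^esub> ?f ?q"
    proof -
      have "?m = l \<otimes>\<^bsub>?B\<^esub> ?q"
        using B.m_assoc[of l "inv\<^bsub>?B\<^esub> l" ?m] B.r_inv[of l] lB mB B.inv_closed[of l] B.l_one[of ?m]
        by (simp del: B.r_inv B.l_one)
      then show ?thesis using A.hom_mult[of l ?q] qB lB by simp
    qed
    ultimately show "?f ?m = ?f l"
      using A.H.r_one[OF A.hom_closed[of l]] lB by simp
  qed
  ultimately have "?f (l [^]\<^bsub>?B\<^esub> card (rcosets B)) = \<one>\<^bsub>?A\<^esub>"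
    using Y.FactGroup_pow[of l "card (rcosets B)"] lB by simp
  then have "l [^]\<^bsub>?B\<^esub> card (rcosets B) \<in> Y"
    using Y.mem_iff_coset[of "l [^]\<^bsub>?B\<^esub> card (rcosets B)"] B.nat_pow_closed[of l] lB by simp
  then have "commutator ?B (l [^] card (rcosets B)) u \<in> ?V"
    using u nat_pow_consistent[of l "card (rcosets B)" B] by (auto simp: Y_def centralizer_mod_def)
  then have "commutator ?B u (l [^] card (rcosets B)) \<in> ?V"
    using B.commutator_mem_sym[OF VB.normal_axioms, of u "l [^] card (rcosets B)"] uB
      subgroup_nat_pow_closed[OF B(1) lB] by simp
  then show ?thesis
    using cons[OF uB subgroup_nat_pow_closed[OF B(1) lB]] by simp
qed

text \<open>Schreier's argument: finitely many word values generate \<open>V(G)\<close>, so its subgroup \<open>L\<close> of finite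
  index is finitely generated, and it is abelian of finite exponent.\<close>

theorem (in group) finite_normal_in_verbal_subgroup:
  assumes v: "outer_commutator_word v" and L: "L \<lhd> G" "finite (rcosets L)"
    "L \<subseteq> verbal_subgroup {v} G" "word_values {v} G \<inter> L \<subseteq> {\<one>}"
  shows "finite L"
proof -
  let ?T = "word_values {v} G" and ?V = "verbal_subgroup {v} G"
  interpret L: normal L G by (rule L)
  interpret V: normal ?V G by (rule verbal_subgroup_normal)
  have gen1: "generate G (?T \<inter> L) = {\<one>}"
    using mono_generate[OF L(4)] generate.one by (auto simp: generate_one)
  \<comment> \<open>With no nontrivial values in L, \<open>word_eval_cong_mod\<close> makes a value
    depend only on the L-cosets of its finitely many arguments.\<close>
  have "finite ((\<lambda>e. word_eval G e v) ` {e. \<forall>i. e i \<in> carrier G})"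
  proof (rule finite_image_factor)
    have "finite (word_vars v)" by (induction v) auto
    then have "finite (PiE (word_vars v) (\<lambda>_. rcosets L))" using L(2) by (intro finite_PiE) auto
    moreover have "(\<lambda>e. restrict (\<lambda>i. L #> e i) (word_vars v)) ` {e. \<forall>i. e i \<in> carrier G}
        \<subseteq> PiE (word_vars v) (\<lambda>_. rcosets L)"
      by (auto simp: RCOSETS_def)
    ultimately show "finite ((\<lambda>e. restrict (\<lambda>i. L #> e i) (word_vars v)) ` {e. \<forall>i. e i \<in> carrier G})"
      by (rule finite_subset[rotated])
  next
    fix e e' assume e: "e \<in> {e. \<forall>i. e i \<in> carrier G}" "e' \<in> {e. \<forall>i. e i \<in> carrier G}"
      and eq: "restrict (\<lambda>i. L #> e i) (word_vars v) = restrict (\<lambda>i. L #> e' i) (word_vars v)"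
    have "L #> e i = L #> e' i" if "i \<in> word_vars v" for i
      using fun_cong[OF eq, of i] that by simp
    then have "{\<one>} #> word_eval G e v = {\<one>} #> word_eval G e' v"
      using word_eval_cong_mod[OF v L(1), of e e'] e gen1 by simp
    then show "word_eval G e v = word_eval G e' v"
      using e word_eval_closed by (simp add: r_coset_def)
  qed
  then have Tfin: "finite ?T" by (simp add: word_values_single image_Collect)
  obtain k :: nat where k: "k > 0" "\<And>x. x \<in> ?V \<Longrightarrow> x [^] k = \<one>"
    using verbal_subgroup_bounded_exponent[OF v L(1,2)] gen1 by auto
  let ?L = "G\<lparr>carrier := L\<rparr>"
  have "comm_group ?L"
  proof (rule group.group_comm_groupI[OF subgroup.subgroup_is_group[OF L.subgroup_axioms is_group]])
    fix x y assume xy: "x \<in> carrier ?L" "y \<in> carrier ?L"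
    then have "commutator G x y = \<one>"
      using normal_commutes_verbal_mod[OF v L(1), of x y] L(3) gen1 by auto
    then show "x \<otimes>\<^bsub>?L\<^esub> y = y \<otimes>\<^bsub>?L\<^esub> x"
      using commutator_eq_one_iff[of x y] xy L.mem_carrier by simp
  qed
  then interpret L': comm_group ?L .
  define \<rho> where "\<rho> C = (SOME y. y \<in> ?V \<and> L #> y = C)" for C
  have rho: "\<rho> (L #> x) \<in> ?V \<and> L #> \<rho> (L #> x) = L #> x" if "x \<in> ?V" for x
    unfolding \<rho>_def by (rule someI[of _ x]) (use that in simp)
  let ?C = "(\<lambda>x. L #> x) ` ?V"
  have "finite ?C"
    by (rule finite_subset[OF _ L(2)]) (auto simp: RCOSETS_def intro!: bexI V.mem_carrier)
  then have Yfin: "finite (\<rho> ` ?C)" by simp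
  have YV: "y \<in> ?V" if "y \<in> \<rho> ` ?C" for y using that rho by auto
  \<comment> \<open>Inverses are included because V(G) is generated as a group; \<one> is included
    so that the empty product is also a step.\<close>
  define S where "S = insert \<one> (?T \<union> m_inv G ` ?T)"
  have SV: "S \<subseteq> ?V"
  proof -
    have "?T \<subseteq> ?V" unfolding verbal_subgroup_def by (auto intro: generate.incl)
    then show ?thesis by (auto simp: S_def)
  qed
  define q where "q y t = y \<otimes> t \<otimes> inv (\<rho> (L #> (y \<otimes> t)))" for y t
  have q: "q y t \<in> L" "y \<otimes> t = q y t \<otimes> \<rho> (L #> (y \<otimes> t))" if "y \<in> ?V" "t \<in> ?V" for y t
  proof -
    have yt: "y \<otimes> t \<in> ?V" using that by blast
    have c: "y \<otimes> t \<in> carrier G" "\<rho> (L #> (y \<otimes> t)) \<in> carrier G"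
      using rho[OF yt] yt V.mem_carrier by auto
    have "y \<otimes> t \<in> L #> \<rho> (L #> (y \<otimes> t))"
      using rho[OF yt] rcos_self[OF c(1) L.subgroup_axioms] by simp
    then show "q y t \<in> L"
      unfolding q_def using L.rcos_module_imp[OF is_group c(2)] by simp
    show "y \<otimes> t = q y t \<otimes> \<rho> (L #> (y \<otimes> t))"
      unfolding q_def using c by (metis inv_solve_right' m_closed inv_closed)
  qed
  \<comment> \<open>These are the Schreier generators. The chosen representative of L itself may
    differ from \<one>, so \<one> is added; the generator \<open>q \<one> \<one>\<close> then
    accounts for the difference.\<close>
  have "finite ((\<lambda>(y, t). q y t) ` (insert \<one> (\<rho> ` ?C) \<times> S))"
    using Yfin Tfin by (simp add: S_def)
  moreover have qL: "(\<lambda>(y, t). q y t) ` (insert \<one> (\<rho> ` ?C) \<times> S) \<subseteq> carrier ?L"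
  proof (rule image_subsetI, clarify)
    fix y t assume yt: "y \<in> insert \<one> (\<rho> ` ?C)" "t \<in> S"
    have "y \<in> ?V" using yt(1) YV V.one_closed by blast
    then show "q y t \<in> carrier ?L" using q(1) yt(2) SV by auto
  qed
  moreover have "\<exists>k::nat. k > 0 \<and> x [^]\<^bsub>?L\<^esub> k = \<one>\<^bsub>?L\<^esub>"
    if "x \<in> (\<lambda>(y, t). q y t) ` (insert \<one> (\<rho> ` ?C) \<times> S)" for x
  proof (intro exI conjI)
    have "x \<in> ?V" using subsetD[OF qL that] L(3) by auto
    then show "x [^]\<^bsub>?L\<^esub> k = \<one>\<^bsub>?L\<^esub>" using k(2) nat_pow_consistent[of x k L] by simp
  qed (rule k(1))
  ultimately obtain M where M: "subgroup M ?L" "finite M"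
    "(\<lambda>(y, t). q y t) ` (insert \<one> (\<rho> ` ?C) \<times> S) \<subseteq> M"
    using L'.finite_subgroup_containing by metis
  have MG: "subgroup M G" by (rule incl_subgroup[OF L.subgroup_axioms M(1)])
  \<comment> \<open>This finite set contains \<one> and is stable under right multiplication by S,
    so it contains all of V(G).\<close>
  let ?P = "M <#> (\<rho> ` ?C)"
  have step: "z \<otimes> t \<in> ?P" if z: "z \<in> ?P" and t: "t \<in> S" for z t
  proof -
    obtain m y where my: "m \<in> M" "y \<in> \<rho> ` ?C" "z = m \<otimes> y" using z by (auto simp: set_mult_def)
    have yV: "y \<in> ?V" by (rule YV[OF my(2)])
    have tV: "t \<in> ?V" using t SV by (rule rev_subsetD)
    have yt: "y \<otimes> t \<in> ?V" using yV tV by blast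
    have c: "m \<in> carrier G" "y \<in> carrier G" "t \<in> carrier G"
      using subgroup.mem_carrier[OF MG my(1)] V.mem_carrier[OF yV] V.mem_carrier[OF tV] by simp_all
    have qM: "q y t \<in> M" using M(3) my t by auto
    have "z \<otimes> t = m \<otimes> (q y t \<otimes> \<rho> (L #> (y \<otimes> t)))"
      using c q(2)[OF yV tV] by (simp add: my m_assoc)
    also have "\<dots> = (m \<otimes> q y t) \<otimes> \<rho> (L #> (y \<otimes> t))"
      using c rho[OF yt] subgroup.mem_carrier[OF MG qM] V.mem_carrier by (simp add: m_assoc)
    also have "\<dots> \<in> ?P"
      by (rule set_mult_memI[OF subgroup.m_closed[OF MG my(1) qM]]) (use yt in blast)
    finally show ?thesis .
  qed
  have gen: "z \<otimes> x \<in> ?P" if "x \<in> generate G ?T" "z \<in> ?P" for x z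
    using that
  proof (induction arbitrary: z rule: generate.induct)
    case one
    then show ?case using step[of z \<one>] by (simp add: S_def)
  next
    case (incl h)
    then show ?case using step[of z h] by (simp add: S_def)
  next
    case (inv h)
    then show ?case using step[of z "inv h"] by (simp add: S_def)
  next
    case (eng h1 h2)
    have "z \<in> carrier G"
      using eng.prems set_mult_closed[OF subgroup.subset[OF MG], of "\<rho> ` ?C"] YV V.subset by blast
    moreover have "h1 \<in> carrier G" "h2 \<in> carrier G"
      using eng.hyps generate_in_carrier[OF word_values_carrier] by auto
    ultimately show ?case using eng.IH(2)[OF eng.IH(1)[OF eng.prems]] by (simp add: m_assoc)
  qed
  have one: "\<one> \<in> ?P"
  proof -
    have "\<one> \<in> ?V" by (rule V.one_closed)
    then have "\<one> = q \<one> \<one> \<otimes> \<rho> (L #> (\<one> \<otimes> \<one>))" using q(2)[of \<one> \<one>] by simp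
    moreover have "q \<one> \<one> \<in> M" using M(3) by (force simp: S_def)
    moreover have "\<rho> (L #> (\<one> \<otimes> \<one>)) \<in> \<rho> ` ?C" using \<open>\<one> \<in> ?V\<close> by auto
    ultimately show ?thesis using set_mult_memI by metis
  qed
  have "?V \<subseteq> ?P"
  proof
    fix x assume x: "x \<in> ?V"
    then have "\<one> \<otimes> x \<in> ?P" using gen[OF _ one, of x] by (simp add: verbal_subgroup_def)
    then show "x \<in> ?P" using V.mem_carrier[OF x] by simp
  qed
  moreover have "finite ?P" using M(2) Yfin by (rule finite_set_mult)
  ultimately show ?thesis using L(3) by (meson finite_subset)
qed

section \<open>The invariant of a subgroup\<close>

text \<open>One preimage for each element of S generates a finite subgroup, since A is abelian and
  torsion. This reduces the claim to a quotient of a finite abelian group.\<close>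

lemma finite_subgroup_of_image_embeds:
  assumes "comm_group A" and tors: "\<And>x. x \<in> carrier A \<Longrightarrow> \<exists>k::nat. k > 0 \<and> x [^]\<^bsub>A\<^esub> k = \<one>\<^bsub>A\<^esub>"
    and "group T" "\<phi> \<in> hom A T" and S: "subgroup S T" "finite S" "S \<subseteq> \<phi> ` carrier A"
  shows "\<exists>K. subgroup K A \<and> T\<lparr>carrier := S\<rparr> \<cong> A\<lparr>carrier := K\<rparr>"
proof -
  interpret A: comm_group A by fact
  interpret T: group T by fact
  interpret h: group_hom A T \<phi>
    using assms(4) by (simp add: group_hom_def group_hom_axioms_def A.is_group T.is_group)
  let ?a = "inv_into (carrier A) \<phi>"
  have a: "?a s \<in> carrier A" "\<phi> (?a s) = s" if "s \<in> S" for s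
    using that S(3) by (auto intro: inv_into_into f_inv_into_f)
  obtain M where M: "subgroup M A" "finite M" "?a ` S \<subseteq> M"
    using A.finite_subgroup_containing[of "?a ` S"] tors a S(2) by force
  \<comment> \<open>M may also contain elements whose image is outside S; cutting them away makes
    the restricted map land exactly on S.\<close>
  let ?M = "{x \<in> M. \<phi> x \<in> S}"
  have Mc: "x \<in> carrier A" if "x \<in> M" for x using subgroup.mem_carrier[OF M(1) that] .
  have sub: "subgroup ?M A"
  proof (rule A.subgroupI)
    show "?M \<noteq> {}"
      using subgroup.one_closed[OF M(1)] subgroup.one_closed[OF S(1)] by auto
  qed (use Mc subgroup.m_inv_closed[OF M(1)] subgroup.m_inv_closed[OF S(1)]
       subgroup.m_closed[OF M(1)] subgroup.m_closed[OF S(1)] in auto)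
  let ?A = "A\<lparr>carrier := ?M\<rparr>"
  have cg: "comm_group ?A"
    by (rule group.group_comm_groupI[OF subgroup.subgroup_is_group[OF sub A.is_group]])
       (use Mc in \<open>auto simp: A.m_comm\<close>)
  have "\<exists>K. subgroup K ?A \<and> T\<lparr>carrier := S\<rparr> \<cong> ?A\<lparr>carrier := K\<rparr>"
  proof (rule finite_abelian_quotient_embeds[OF cg _ subgroup.subgroup_is_group[OF S(1) T.is_group]])
    show "finite (carrier ?A)" using M(2) by simp
    show "\<phi> \<in> hom ?A (T\<lparr>carrier := S\<rparr>)"
      by (rule homI) (use Mc in auto)
    show "\<phi> ` carrier ?A = carrier (T\<lparr>carrier := S\<rparr>)"
    proof (intro subset_antisym subsetI)
      fix s assume "s \<in> carrier (T\<lparr>carrier := S\<rparr>)"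
      then have s: "s \<in> S" by simp
      then have "?a s \<in> carrier ?A" using M(3) a by auto
      then show "s \<in> \<phi> ` carrier ?A" using a(2)[OF s] by (intro image_eqI[of s \<phi> "?a s"]) simp_all
    qed auto
  qed
  then obtain K where K: "subgroup K ?A" "T\<lparr>carrier := S\<rparr> \<cong> ?A\<lparr>carrier := K\<rparr>" by blast
  then show ?thesis using A.incl_subgroup[OF sub K(1)] by auto
qed

text \<open>The isomorphism of F/R with E/L is lifted by choosing coset representatives for the free
  generators. The lift need not be onto E, so the last conclusion speaks only of cosets of
  L.\<close>

lemma free_presentation_lift:
  assumes pres: "free_presentation F R Q" and L: "L \<lhd> E" and iso: "Q \<cong> (E Mod L)"
  obtains \<beta> where "\<beta> \<in> hom F E" "\<And>f. f \<in> carrier F \<Longrightarrow> \<beta> f \<in> L \<longleftrightarrow> f \<in> R"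
    "\<And>e. e \<in> carrier E \<Longrightarrow> \<exists>f\<in>carrier F. L #>\<^bsub>E\<^esub> e = L #>\<^bsub>E\<^esub> \<beta> f"
proof -
  obtain X where X: "free_on F X" and R: "R \<lhd> F" and FQ: "(F Mod R) \<cong> Q"
    using pres by (auto simp: free_presentation_def)
  interpret R: normal R F by (rule R)
  interpret L: normal L E by (rule L)
  interpret p: group_hom F "F Mod R" "\<lambda>a. R #>\<^bsub>F\<^esub> a" by (rule R.coset_hom)
  interpret q: group_hom E "E Mod L" "\<lambda>a. L #>\<^bsub>E\<^esub> a" by (rule L.coset_hom)
  obtain \<theta> where theta: "\<theta> \<in> iso (F Mod R) (E Mod L)"
    using iso_trans[OF FQ iso] by (auto simp: is_iso_def)
  then have tb: "bij_betw \<theta> (carrier (F Mod R)) (carrier (E Mod L))" by (simp add: iso_def)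
  interpret t: group_hom "F Mod R" "E Mod L" \<theta>
    using theta by (auto simp: group_hom_def group_hom_axioms_def iso_def p.H.is_group q.H.is_group)
  have Xc: "X \<subseteq> carrier F" and gen: "generate F X = carrier F" using X by (auto simp: free_on_def)
  have "\<exists>e. e \<in> carrier E \<and> \<theta> (R #>\<^bsub>F\<^esub> f) = L #>\<^bsub>E\<^esub> e" if f: "f \<in> carrier F" for f
    using t.hom_closed[OF p.hom_closed[OF f]] by (auto simp: carrier_FactGroup)
  then obtain c where c: "\<And>f. f \<in> carrier F \<Longrightarrow> c f \<in> carrier E \<and> \<theta> (R #>\<^bsub>F\<^esub> f) = L #>\<^bsub>E\<^esub> c f"
    by metis
  obtain \<beta> where beta: "\<beta> \<in> hom F E" "\<And>x. x \<in> X \<Longrightarrow> \<beta> x = c x"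
    using free_on_universal[OF X L.is_group, of c] c Xc by blast
  interpret b: group_hom F E \<beta>
    using beta(1) by (simp add: group_hom_def group_hom_axioms_def R.is_group L.is_group)
  have eq: "L #>\<^bsub>E\<^esub> \<beta> f = \<theta> (R #>\<^bsub>F\<^esub> f)" if f: "f \<in> generate F X" for f
    using f
  proof (induction rule: generate.induct)
    case one
    then show ?case using q.hom_one t.hom_one p.hom_one b.hom_one by simp
  next
    case (incl x)
    then show ?case using beta(2) c Xc by auto
  next
    case (inv x)
    then have x: "x \<in> carrier F" "L #>\<^bsub>E\<^esub> \<beta> x = \<theta> (R #>\<^bsub>F\<^esub> x)" using beta(2) c Xc by auto
    have "L #>\<^bsub>E\<^esub> \<beta> (inv\<^bsub>F\<^esub> x) = inv\<^bsub>E Mod L\<^esub> (L #>\<^bsub>E\<^esub> \<beta> x)"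
      using b.hom_inv[OF x(1)] q.hom_inv[OF b.hom_closed[OF x(1)]] by (simp only:)
    also have "\<dots> = \<theta> (R #>\<^bsub>F\<^esub> inv\<^bsub>F\<^esub> x)"
      using p.hom_inv[OF x(1)] t.hom_inv[OF p.hom_closed[OF x(1)]] x(2) by (simp only:)
    finally show ?case .
  next
    case (eng x y)
    have x: "x \<in> carrier F" "y \<in> carrier F" using eng.hyps gen by auto
    have "L #>\<^bsub>E\<^esub> \<beta> (x \<otimes>\<^bsub>F\<^esub> y) = (L #>\<^bsub>E\<^esub> \<beta> x) \<otimes>\<^bsub>E Mod L\<^esub> (L #>\<^bsub>E\<^esub> \<beta> y)"
      using b.hom_mult[OF x] q.hom_mult[OF b.hom_closed[OF x(1)] b.hom_closed[OF x(2)]] by (simp only:)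
    also have "\<dots> = \<theta> (R #>\<^bsub>F\<^esub> (x \<otimes>\<^bsub>F\<^esub> y))"
      using p.hom_mult[OF x] t.hom_mult[OF p.hom_closed[OF x(1)] p.hom_closed[OF x(2)]] eng.IH
      by (simp only:)
    finally show ?case .
  qed
  show thesis
  proof (rule that[OF beta(1)])
    fix f assume f: "f \<in> carrier F"
    have "\<beta> f \<in> L \<longleftrightarrow> \<theta> (R #>\<^bsub>F\<^esub> f) = \<one>\<^bsub>E Mod L\<^esub>"
      using L.mem_iff_coset[OF b.hom_closed[OF f]] eq[of f] f gen by simp
    also have "\<dots> \<longleftrightarrow> R #>\<^bsub>F\<^esub> f = \<one>\<^bsub>F Mod R\<^esub>"
      using inj_onD[OF bij_betw_imp_inj_on[OF tb], of "R #>\<^bsub>F\<^esub> f" "\<one>\<^bsub>F Mod R\<^esub>"]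
        t.hom_one p.hom_closed[OF f] p.H.one_closed by metis
    also have "\<dots> \<longleftrightarrow> f \<in> R" using R.mem_iff_coset[OF f] by simp
    finally show "\<beta> f \<in> L \<longleftrightarrow> f \<in> R" .
  next
    fix e assume e: "e \<in> carrier E"
    have "L #>\<^bsub>E\<^esub> e \<in> \<theta> ` carrier (F Mod R)"
      using q.hom_closed[OF e] bij_betw_imp_surj_on[OF tb] by simp
    then show "\<exists>f\<in>carrier F. L #>\<^bsub>E\<^esub> e = L #>\<^bsub>E\<^esub> \<beta> f"
      using eq gen by (auto simp: carrier_FactGroup)
  qed
qed

section \<open>The invariant as an abelian torsion group and its map to the kernel\<close>

lemma (in group) B0_invariant_normal:
  assumes "R \<lhd> G"
  shows "subgroup (R \<inter> verbal_subgroup {v} G) G"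
    "generate G (word_values {v} G \<inter> R) \<lhd> G\<lparr>carrier := R \<inter> verbal_subgroup {v} G\<rparr>"
proof -
  show D: "subgroup (R \<inter> verbal_subgroup {v} G) G"
    using assms verbal_subgroup_normal by (intro subgroups_Inter_pair normal_imp_subgroup)
  have "generate G (word_values {v} G \<inter> R) \<subseteq> R \<inter> verbal_subgroup {v} G"
    by (rule generate_subgroup_incl[OF _ D]) (auto simp: verbal_subgroup_def intro: generate.incl)
  then show "generate G (word_values {v} G \<inter> R) \<lhd> G\<lparr>carrier := R \<inter> verbal_subgroup {v} G\<rparr>"
    by (rule normal_restrict_supergroup[OF D generate_word_values_Int_normal[OF assms]])
qed

lemma (in group) B0_invariant_comm_group:
  assumes v: "outer_commutator_word v" and R: "R \<lhd> G"
  shows "comm_group (B0_invariant {v} G R)"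
proof -
  let ?D = "G\<lparr>carrier := R \<inter> verbal_subgroup {v} G\<rparr>"
  note D = B0_invariant_normal[OF R, of v]
  interpret S: normal "generate G (word_values {v} G \<inter> R)" ?D by (rule D(2))
  interpret q: group_hom ?D "B0_invariant {v} G R"
      "\<lambda>a. generate G (word_values {v} G \<inter> R) #>\<^bsub>?D\<^esub> a"
    unfolding B0_invariant_def by (rule S.coset_hom)
  show ?thesis
  proof (rule q.H.group_comm_groupI)
    fix x y assume "x \<in> carrier (B0_invariant {v} G R)" "y \<in> carrier (B0_invariant {v} G R)"
    then obtain a b where a: "a \<in> carrier ?D" "x = generate G (word_values {v} G \<inter> R) #>\<^bsub>?D\<^esub> a"
      and b: "b \<in> carrier ?D" "y = generate G (word_values {v} G \<inter> R) #>\<^bsub>?D\<^esub> b"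
      unfolding B0_invariant_def carrier_FactGroup by blast
    have "commutator ?D a b = commutator G a b"
      by (rule commutator_subgroup_consistent[OF D(1)]) (use a b in simp_all)
    moreover have "commutator G a b \<in> generate G (word_values {v} G \<inter> R)"
      by (rule normal_commutes_verbal_mod[OF v R]) (use a b in simp_all)
    ultimately show "x \<otimes>\<^bsub>B0_invariant {v} G R\<^esub> y = y \<otimes>\<^bsub>B0_invariant {v} G R\<^esub> x"
      using S.commutator_mem_iff[OF a(1) b(1)] q.hom_mult[OF a(1) b(1)] q.hom_mult[OF b(1) a(1)]
      by (simp only: a(2) b(2))
  qed
qed

lemma (in group) B0_invariant_torsion:
  assumes v: "outer_commutator_word v" and R: "R \<lhd> G" "finite (rcosets R)"
    and x: "x \<in> carrier (B0_invariant {v} G R)"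
  shows "\<exists>k::nat. k > 0 \<and> x [^]\<^bsub>B0_invariant {v} G R\<^esub> k = \<one>\<^bsub>B0_invariant {v} G R\<^esub>"
proof -
  let ?D = "G\<lparr>carrier := R \<inter> verbal_subgroup {v} G\<rparr>" and ?S = "generate G (word_values {v} G \<inter> R)"
  interpret S: normal ?S ?D by (rule B0_invariant_normal[OF R(1)])
  obtain a where a: "a \<in> carrier ?D" "x = ?S #>\<^bsub>?D\<^esub> a"
    using x unfolding B0_invariant_def carrier_FactGroup by blast
  obtain k :: nat where k: "k > 0" "\<And>y. y \<in> verbal_subgroup {v} G \<Longrightarrow> y [^] k \<in> ?S"
    using verbal_subgroup_bounded_exponent[OF v R] by blast
  have "a [^]\<^bsub>?D\<^esub> k \<in> ?S" using k(2)[of a] a(1) by (simp flip: nat_pow_consistent)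
  then have "?S #>\<^bsub>?D\<^esub> (a [^]\<^bsub>?D\<^esub> k) = ?S"
    using S.mem_iff_coset S.mem_carrier by blast
  then have "x [^]\<^bsub>?D Mod ?S\<^esub> k = \<one>\<^bsub>?D Mod ?S\<^esub>"
    using S.FactGroup_pow[OF a(1), of k] by (simp add: a(2))
  then show ?thesis unfolding B0_invariant_def using k(1) by blast
qed

text \<open>Values of v in R are sent to values in L, hence to \<one>, so \<open>\<beta>\<close>
  descends to the invariant. For the image, it matters that v only sees arguments modulo L.\<close>

lemma B0_invariant_onto:
  assumes v: "outer_commutator_word v" and R: "R \<lhd> F" and L: "L \<lhd> E" "word_values {v} E \<inter> L \<subseteq> {\<one>\<^bsub>E\<^esub>}"
    and beta: "\<beta> \<in> hom F E" "\<And>f. f \<in> carrier F \<Longrightarrow> \<beta> f \<in> L \<longleftrightarrow> f \<in> R"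
      "\<And>e. e \<in> carrier E \<Longrightarrow> \<exists>f\<in>carrier F. L #>\<^bsub>E\<^esub> e = L #>\<^bsub>E\<^esub> \<beta> f"
  obtains \<phi> where "\<phi> \<in> hom (B0_invariant {v} F R) (E\<lparr>carrier := L\<rparr>)"
    "L \<inter> verbal_subgroup {v} E \<subseteq> \<phi> ` carrier (B0_invariant {v} F R)"
proof -
  interpret R: normal R F by (rule R)
  interpret L: normal L E by (rule L)
  interpret b: group_hom F E \<beta>
    using beta(1) by (simp add: group_hom_def group_hom_axioms_def R.is_group L.is_group)
  let ?DC = "R \<inter> verbal_subgroup {v} F"
  let ?D = "F\<lparr>carrier := ?DC\<rparr>" and ?S = "generate F (word_values {v} F \<inter> R)"
  let ?L = "E\<lparr>carrier := L\<rparr>"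
  note D = R.B0_invariant_normal[OF R, of v]
  have val: "\<beta> (word_eval F e v) = word_eval E (\<lambda>i. \<beta> (e i)) v" if "\<And>i. e i \<in> carrier F" for e
    by (rule b.hom_word_eval[OF that])
  have T1: "\<beta> x = \<one>\<^bsub>E\<^esub>" if x: "x \<in> word_values {v} F \<inter> R" for x
  proof -
    obtain e where e: "x = word_eval F e v" "\<And>i. e i \<in> carrier F"
      using x by (auto simp: word_values_single)
    have "\<beta> x \<in> word_values {v} E"
      unfolding word_values_single using val[of e] e b.hom_closed by blast
    moreover have "\<beta> x \<in> L" using x beta(2) R.mem_carrier by auto
    ultimately show ?thesis using L(2) by blast
  qed
  have hom: "\<beta> \<in> hom ?D ?L"
    by (rule homI) (use beta(2) R.mem_carrier in auto)
  interpret D: group ?D by (rule subgroup.subgroup_is_group[OF D(1) R.is_group])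
  interpret bD: group_hom ?D ?L \<beta>
    using hom L.subgroup_is_group[OF L.is_group]
    by (simp add: group_hom_def group_hom_axioms_def D.is_group)
  have "?S \<subseteq> kernel F E \<beta>"
    by (rule R.generate_subgroup_incl[OF _ b.subgroup_kernel])
       (use T1 R.mem_carrier in \<open>auto simp: kernel_def\<close>)
  then have "?S \<subseteq> kernel ?D ?L \<beta>"
    using subgroup.subset[OF normal_imp_subgroup[OF D(2)]] by (auto simp: kernel_def)
  then obtain \<phi> where phi: "\<phi> \<in> hom (?D Mod ?S) ?L"
    "\<And>x. x \<in> carrier ?D \<Longrightarrow> \<phi> (?S #>\<^bsub>?D\<^esub> x) = \<beta> x"
    using bD.FactGroup_universal_kernel[OF D(2)] by metis
  \<comment> \<open>Although \<open>\<beta>\<close> is onto only modulo L, replacing each argument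
    by an image in the same coset of L leaves the value unchanged.\<close>
  have TE: "word_values {v} E \<subseteq> \<beta> ` word_values {v} F"
  proof
    fix x assume "x \<in> word_values {v} E"
    then obtain e where e: "x = word_eval E e v" "\<And>i. e i \<in> carrier E" by (auto simp: word_values_single)
    obtain f where f: "\<And>i. f i \<in> carrier F" "\<And>i. L #>\<^bsub>E\<^esub> e i = L #>\<^bsub>E\<^esub> \<beta> (f i)"
      using beta(3)[OF e(2)] by metis
    have "generate E (word_values {v} E \<inter> L) = {\<one>\<^bsub>E\<^esub>}"
      using L.mono_generate[OF L(2)] generate.one by (auto simp: L.generate_one)
    then have "{\<one>\<^bsub>E\<^esub>} #>\<^bsub>E\<^esub> word_eval E e v = {\<one>\<^bsub>E\<^esub>} #>\<^bsub>E\<^esub> word_eval E (\<lambda>i. \<beta> (f i)) v"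
      using L.word_eval_cong_mod[OF v L(1), of e "\<lambda>i. \<beta> (f i)"] e f b.hom_closed by auto
    then have "x = \<beta> (word_eval F f v)"
      using L.word_eval_closed[of e v] L.word_eval_closed[of "\<lambda>i. \<beta> (f i)" v] e f b.hom_closed val[of f]
      by (simp add: r_coset_def)
    then show "x \<in> \<beta> ` word_values {v} F" using f(1) unfolding word_values_single by blast
  qed
  have "L \<inter> verbal_subgroup {v} E \<subseteq> \<phi> ` carrier (?D Mod ?S)"
  proof
    fix x assume x: "x \<in> L \<inter> verbal_subgroup {v} E"
    have "verbal_subgroup {v} E \<subseteq> \<beta> ` verbal_subgroup {v} F"
      unfolding verbal_subgroup_def
      using L.mono_generate[OF TE] b.generate_img[OF R.word_values_carrier] by simp
    then obtain g where g: "g \<in> verbal_subgroup {v} F" "x = \<beta> g" using x by auto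
    have "g \<in> carrier F"
      using g(1) normal_imp_subgroup[OF R.verbal_subgroup_normal] subgroup.mem_carrier by metis
    then have "g \<in> carrier ?D" using g x beta(2) by auto
    then have "?S #>\<^bsub>?D\<^esub> g \<in> carrier (?D Mod ?S)" "\<phi> (?S #>\<^bsub>?D\<^esub> g) = x"
      using phi(2) g(2) unfolding carrier_FactGroup by auto
    then show "x \<in> \<phi> ` carrier (?D Mod ?S)" by blast
  qed
  then show thesis using that phi(1) unfolding B0_invariant_def by blast
qed

text \<open>A bijection of cosets transports the index even though the cover is not known to be
  finite. Injectivity holds because the kernel lies in B.\<close>

lemma card_rcosets_surjection:
  assumes "group_hom G H h" "h ` carrier G = carrier H" and B: "subgroup B G" "kernel G H h \<subseteq> B"
  shows "bij_betw (\<lambda>C. h ` C) (rcosets\<^bsub>G\<^esub> B) (rcosets\<^bsub>H\<^esub> (h ` B))"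
proof -
  interpret h: group_hom G H h by fact
  interpret B: subgroup B G by fact
  have hB: "subgroup (h ` B) H" by (rule h.subgroup_img_is_subgroup[OF B(1)])
  have im: "h ` (B #>\<^bsub>G\<^esub> x) = h ` B #>\<^bsub>H\<^esub> h x" if "x \<in> carrier G" for x
    using that by (force simp: r_coset_def image_UN)
  have "inj_on (\<lambda>C. h ` C) (rcosets\<^bsub>G\<^esub> B)"
  proof (rule inj_onI)
    fix C D assume "C \<in> rcosets\<^bsub>G\<^esub> B" "D \<in> rcosets\<^bsub>G\<^esub> B" and eq: "h ` C = h ` D"
    then obtain x y where x: "x \<in> carrier G" "C = B #>\<^bsub>G\<^esub> x" and y: "y \<in> carrier G" "D = B #>\<^bsub>G\<^esub> y"
      by (auto simp: RCOSETS_def)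
    have "h x \<in> h ` B #>\<^bsub>H\<^esub> h y"
      using eq im[OF x(1)] im[OF y(1)] h.H.rcos_self[OF h.hom_closed[OF x(1)] hB] by (simp add: x y)
    then obtain b where b: "b \<in> B" "h x = h b \<otimes>\<^bsub>H\<^esub> h y" by (auto simp: r_coset_def)
    have bc: "b \<in> carrier G" using b(1) by auto
    let ?k = "x \<otimes>\<^bsub>G\<^esub> inv\<^bsub>G\<^esub> (b \<otimes>\<^bsub>G\<^esub> y)"
    have "?k \<in> kernel G H h"
      using x(1) y(1) bc b(2) by (simp add: kernel_def)
    then have kB: "?k \<in> B" using B(2) by blast
    have "x = (?k \<otimes>\<^bsub>G\<^esub> b) \<otimes>\<^bsub>G\<^esub> y"
      using x(1) y(1) bc by (simp add: h.G.m_assoc)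
    moreover have "?k \<otimes>\<^bsub>G\<^esub> b \<in> B" using kB b(1) by blast
    ultimately have "x \<in> B #>\<^bsub>G\<^esub> y" by (auto simp: r_coset_def)
    then show "C = D" using h.G.repr_independence[OF _ y(1) B(1)] by (simp add: x(2) y(2))
  qed
  moreover have "(\<lambda>C. h ` C) ` (rcosets\<^bsub>G\<^esub> B) = rcosets\<^bsub>H\<^esub> (h ` B)"
  proof -
    have "(\<lambda>C. h ` C) ` (rcosets\<^bsub>G\<^esub> B) = (\<lambda>x. h ` B #>\<^bsub>H\<^esub> h x) ` carrier G"
    proof -
      have "rcosets\<^bsub>G\<^esub> B = (\<lambda>x. B #>\<^bsub>G\<^esub> x) ` carrier G" by (auto simp: RCOSETS_def)
      then show ?thesis by (simp only: image_image im cong: image_cong)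
    qed
    also have "\<dots> = (\<lambda>y. h ` B #>\<^bsub>H\<^esub> y) ` (h ` carrier G)" by (simp add: image_image)
    finally show ?thesis using assms(2) by (auto simp: RCOSETS_def)
  qed
  ultimately show ?thesis by (simp add: bij_betw_def)
qed

theorem theorem2p4:
  fixes w :: comm_word and r n :: nat and V :: "comm_word set"
    and G :: "'g monoid" and Gs :: "'e monoid" and \<sigma> :: "'e \<Rightarrow> 'g"
    and L B :: "'e set" and H :: "'g set"
    and F\<^sub>G :: "'f monoid" and R\<^sub>G :: "'f set"
    and F\<^sub>H :: "'h monoid" and R\<^sub>H :: "'h set"
  assumes "outer_commutator_word w" and "word_vars w = {1..r}"
    and "V = {Comm (Comm w (Var (r + 1))) (Var (r + 2))}"
    and "group G" and "finite (carrier G)"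
    and "subgroup L Gs"
    and "VP_cover V F\<^sub>G R\<^sub>G (Gs\<lparr>carrier := L\<rparr>) (\<lambda>x. x) Gs \<sigma> G"
    and "subgroup H G" and "card (rcosets\<^bsub>G\<^esub> H) = n"
    and "subgroup B Gs" and "L \<subseteq> B"
    and "G\<lparr>carrier := H\<rparr> \<cong> (Gs\<lparr>carrier := B\<rparr> Mod L)"
    and "free_presentation F\<^sub>H R\<^sub>H (G\<lparr>carrier := H\<rparr>)"
  shows "\<exists>K. subgroup K (B0_invariant V F\<^sub>H R\<^sub>H) \<and>
    Gs\<lparr>carrier := commutator_subgroup Gs (verbal_subgroup {w} (Gs\<lparr>carrier := B\<rparr>))
                   {x [^]\<^bsub>Gs\<^esub> n | x. x \<in> L}\<rparr>
      \<cong> (B0_invariant V F\<^sub>H R\<^sub>H)\<lparr>carrier := K\<rparr>"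
proof -
  define v where "v = Comm (Comm w (Var (r + 1))) (Var (r + 2))"
  have V: "V = {v}" using assms(3) by (simp add: v_def)
  have fresh: "r + 1 \<notin> word_vars w" "r + 2 \<notin> word_vars w" "r + 1 \<noteq> r + 2"
    using assms(2) by auto
  have outer: "outer_commutator_word v"
    unfolding v_def using assms(1) fresh by (auto intro!: outer_commutator_word.intros)
  have ext: "group Gs" "\<sigma> \<in> hom Gs G" "\<sigma> ` carrier Gs = carrier G" "kernel Gs G \<sigma> = L"
      "L \<inter> word_values {v} Gs = {\<one>\<^bsub>Gs\<^esub>}" "L \<subseteq> verbal_subgroup {v} Gs"
    using assms(7)
    by (auto simp: VP_cover_def stem_VP_extension_def marginal_VP_extension_def
        marginal_extension_def group_extension_def V)
  interpret G: group G by fact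
  interpret E: group Gs by (rule ext(1))
  interpret s: group_hom Gs G \<sigma>
    using ext(2) by (simp add: group_hom_def group_hom_axioms_def E.is_group G.is_group)
  have L: "L \<lhd> Gs" using s.normal_kernel ext(4) by simp
  have LT: "word_values {v} Gs \<inter> L \<subseteq> {\<one>\<^bsub>Gs\<^esub>}" using ext(5) by blast
  have finB: "finite (rcosets\<^bsub>Gs\<^esub> C) \<and> card (rcosets\<^bsub>Gs\<^esub> C) = card (rcosets\<^bsub>G\<^esub> (\<sigma> ` C))"
    if "subgroup C Gs" "L \<subseteq> C" for C
  proof -
    have "bij_betw (\<lambda>D. \<sigma> ` D) (rcosets\<^bsub>Gs\<^esub> C) (rcosets\<^bsub>G\<^esub> (\<sigma> ` C))"
      by (rule card_rcosets_surjection[OF s.group_hom_axioms ext(3) that(1)]) (use ext(4) that(2) in simp)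
    moreover have "finite (rcosets\<^bsub>G\<^esub> (\<sigma> ` C))"
      using assms(5) by (simp add: RCOSETS_def)
    ultimately show ?thesis using bij_betw_finite bij_betw_same_card by blast
  qed
  let ?B = "Gs\<lparr>carrier := B\<rparr>"
  interpret B: group ?B by (rule subgroup.subgroup_is_group[OF assms(10) E.is_group])
  have LB: "L \<lhd> ?B" by (rule E.normal_restrict_supergroup[OF assms(10) L assms(11)])
  \<comment> \<open>The image of B in G need not be H, but both are isomorphic to B/L. They have the
    same order, hence by Lagrange the same index in the finite group G.\<close>
  have n: "card (rcosets\<^bsub>Gs\<^esub> B) = n"
  proof -
    have HB: "subgroup (\<sigma> ` B) G" by (rule s.subgroup_img_is_subgroup[OF assms(10)])
    let ?H = "G\<lparr>carrier := \<sigma> ` B\<rparr>"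
    have Bc: "x \<in> carrier Gs" if "x \<in> B" for x using subgroup.mem_carrier[OF assms(10) that] .
    have "\<sigma> \<in> hom ?B ?H" by (rule homI) (use Bc in auto)
    then interpret sB: group_hom ?B ?H \<sigma>
      using subgroup.subgroup_is_group[OF HB G.is_group]
      by (simp add: group_hom_def group_hom_axioms_def B.is_group)
    have "kernel ?B ?H \<sigma> = L" using ext(4) assms(11) Bc by (auto simp: kernel_def)
    then have "(?B Mod L) \<cong> ?H" using sB.FactGroup_iso by simp
    then have "G\<lparr>carrier := H\<rparr> \<cong> ?H" by (rule iso_trans[OF assms(12)])
    then have "card H = card (\<sigma> ` B)" by (auto simp: is_iso_def iso_def dest: bij_betw_same_card)
    moreover have "card (rcosets\<^bsub>G\<^esub> H) * card H = card (rcosets\<^bsub>G\<^esub> (\<sigma> ` B)) * card (\<sigma> ` B)"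
      using G.lagrange[OF assms(8)] G.lagrange[OF HB] by simp
    moreover have "card H > 0"
      using subgroup.one_closed[OF assms(8)] finite_subset[OF subgroup.subset[OF assms(8)] assms(5)]
      by (auto simp: card_gt_0_iff)
    ultimately show ?thesis using finB[OF assms(10,11)] assms(9) by simp
  qed
  \<comment> \<open>Taking L itself as the subgroup in \<open>finB\<close> gives the finite index
    that is required here.\<close>
  have finL: "finite L"
    by (rule E.finite_normal_in_verbal_subgroup[OF outer L _ ext(6) LT]) (use finB[OF assms(6)] in simp)
  define S where "S = commutator_subgroup Gs (verbal_subgroup {w} ?B) {x [^]\<^bsub>Gs\<^esub> n | x. x \<in> L}"
  have WB: "verbal_subgroup {w} ?B \<subseteq> B"
    using subgroup.subset[OF normal_imp_subgroup[OF B.verbal_subgroup_normal]] by simp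
  have VB: "subgroup (verbal_subgroup {v} ?B) Gs"
    by (rule E.incl_subgroup[OF assms(10) normal_imp_subgroup[OF B.verbal_subgroup_normal]])
  have Sgen: "{commutator Gs m k | m k. m \<in> verbal_subgroup {w} ?B \<and> k \<in> {x [^]\<^bsub>Gs\<^esub> n | x. x \<in> L}}
      \<subseteq> L \<inter> verbal_subgroup {v} ?B" (is "?S \<subseteq> _")
  proof clarify
    fix u l assume u: "u \<in> verbal_subgroup {w} ?B" and l: "l \<in> L"
    have "u \<in> carrier Gs" using u WB subgroup.subset[OF assms(10)] by blast
    then have "commutator Gs u (l [^]\<^bsub>Gs\<^esub> n) \<in> L"
      by (rule E.commutator_mem_normal(1)[OF L]) (rule E.subgroup_nat_pow_closed[OF assms(6) l])
    moreover have "commutator Gs u (l [^]\<^bsub>Gs\<^esub> n) \<in> verbal_subgroup {v} ?B"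
      using E.commutator_verbal_pow_index[OF fresh v_def L ext(6) LT assms(10,11) _ u l]
        finB[OF assms(10,11)] n by simp
    ultimately show "commutator Gs u (l [^]\<^bsub>Gs\<^esub> n) \<in> L \<inter> verbal_subgroup {v} ?B" by blast
  qed
  have SLV: "S \<subseteq> L \<inter> verbal_subgroup {v} ?B"
    unfolding S_def commutator_subgroup_def
    by (rule E.generate_subgroup_incl[OF Sgen E.subgroups_Inter_pair[OF assms(6) VB]])
  have "subgroup S Gs"
    unfolding S_def commutator_subgroup_def
    by (rule E.generate_is_subgroup) (use Sgen subgroup.subset[OF assms(6)] in blast)
  then have SL: "subgroup S (Gs\<lparr>carrier := L\<rparr>)"
    by (rule E.subgroup_incl[OF _ assms(6)]) (use SLV in blast)
  have F: "R\<^sub>H \<lhd> F\<^sub>H" "(F\<^sub>H Mod R\<^sub>H) \<cong> G\<lparr>carrier := H\<rparr>"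
    using assms(13) by (auto simp: free_presentation_def)
  interpret F: group F\<^sub>H using F(1) by (simp add: normal_def)
  \<comment> \<open>F/R is in bijection with the finite group H, whatever the rank of F.\<close>
  have finR: "finite (rcosets\<^bsub>F\<^sub>H\<^esub> R\<^sub>H)"
  proof -
    have "finite H" using finite_subset[OF subgroup.subset[OF assms(8)] assms(5)] .
    moreover obtain h where "bij_betw h (rcosets\<^bsub>F\<^sub>H\<^esub> R\<^sub>H) H"
      using F(2) by (auto simp: is_iso_def iso_def FactGroup_def)
    ultimately show ?thesis using bij_betw_finite by blast
  qed
  obtain \<beta> where beta: "\<beta> \<in> hom F\<^sub>H ?B" "\<And>f. f \<in> carrier F\<^sub>H \<Longrightarrow> \<beta> f \<in> L \<longleftrightarrow> f \<in> R\<^sub>H"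
    "\<And>e. e \<in> carrier ?B \<Longrightarrow> \<exists>f\<in>carrier F\<^sub>H. L #>\<^bsub>?B\<^esub> e = L #>\<^bsub>?B\<^esub> \<beta> f"
    by (rule free_presentation_lift[OF assms(13) LB assms(12)]) blast
  \<comment> \<open>Values of v in B are values in the whole cover, so the condition on L passes to
    B.\<close>
  have LTB: "word_values {v} ?B \<inter> L \<subseteq> {\<one>\<^bsub>?B\<^esub>}"
    using LT E.word_values_subgroup[OF assms(10), of v] by auto
  obtain \<phi> where phi: "\<phi> \<in> hom (B0_invariant {v} F\<^sub>H R\<^sub>H) (?B\<lparr>carrier := L\<rparr>)"
    "L \<inter> verbal_subgroup {v} ?B \<subseteq> \<phi> ` carrier (B0_invariant {v} F\<^sub>H R\<^sub>H)"
    by (rule B0_invariant_onto[OF outer F(1) LB LTB beta])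
  \<comment> \<open>The commutator subgroup S is finite and lies in
    \<open>L \<inter> verbal_subgroup {v} ?B\<close>, which the image of the abelian torsion
    invariant covers.\<close>
  have "\<exists>K. subgroup K (B0_invariant {v} F\<^sub>H R\<^sub>H) \<and>
      Gs\<lparr>carrier := L\<rparr>\<lparr>carrier := S\<rparr> \<cong> (B0_invariant {v} F\<^sub>H R\<^sub>H)\<lparr>carrier := K\<rparr>"
  proof (rule finite_subgroup_of_image_embeds[OF F.B0_invariant_comm_group[OF outer F(1)]
        F.B0_invariant_torsion[OF outer F(1) finR] subgroup.subgroup_is_group[OF assms(6) E.is_group] _ SL])
    show "\<phi> \<in> hom (B0_invariant {v} F\<^sub>H R\<^sub>H) (Gs\<lparr>carrier := L\<rparr>)" using phi(1) by simp
    show "finite S" using SLV finL by (meson finite_Int finite_subset)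
    show "S \<subseteq> \<phi> ` carrier (B0_invariant {v} F\<^sub>H R\<^sub>H)" using SLV phi(2) by blast
  qed
  then show ?thesis by (simp add: V S_def)
qed

end
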